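(* Let $X\subseteq\mathbb{R}^p$, $U\subseteq\mathbb{R}^q$ be open, $n\ge1$, and let $\mathcal{S}_\Delta\subseteq J^n$ be the zero set of smooth functions $\Delta^1,\dots,\Delta^s\in C^\infty(J^n)$. Let $L$ be a rectifiable PDE Lie algebra of vector fields on $X\times U$ and $L'$ an associated rectified PDE Lie algebra with basis $Z_k=\partial_{x^k}+\sum_{\alpha=1}^q\phi^\alpha_k(x,u)\partial_{u^\alpha}$, $k=1,\dots,p$. Suppose that $\Delta^\mu(x^j,u^\alpha,D_K\phi^\alpha_j)=0$ identically for all $\mu=1,\dots,s$, i.e. every $\Delta^\mu$ vanishes at every point of $\mathcal{S}^n_{L'}=\{u^\alpha_{K,j}=D_K\phi^\alpha_j,\ |K|\le n-1\}$ (where the $D_K\phi^\alpha_j$ are evaluated on $\mathcal{S}^n_{L'}$, so that they are functions of $(x,u)$). Then $L$ is a Lie algebra of conditional symmetries of $\mathcal{S}_\Delta$: for every $Y\in L$, $\mathbf{j}^nY$ is tangent to $\mathcal{S}_\Delta\cap\mathcal{S}^n_L=\mathcal{S}^n_L$ and $(\mathbf{j}^nY)(\Delta^\mu)=0$ at every point of $\mathcal{S}^n_L$, $\mu=1,\dots,s$.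
   Context: Setting: $J^0=X\times U$, $\pi^0_{-1}:X\times U\to X$, $J^n$ the $n$-th jet bundle of $\pi^0_{-1}$, coordinates $(x^i,u^\alpha,u^\alpha_K)$, $u^\alpha_{K,j}$ the coordinate with multi-index $K$ increased by one in slot $j$, total derivatives $D_i=\partial_{x^i}+\sum_{K,\alpha}u^\alpha_{K,i}\partial_{u^\alpha_K}$, $D_K=D_1^{k_1}\cdots D_p^{k_p}$; $\mathbf{j}^nY$ is the prolongation of $Y$ to $J^n$. For $Y=\sum_i\xi^i\partial_{x^i}+\sum_\alpha\varphi^\alpha\partial_{u^\alpha}$ the characteristics are $Q^\alpha_Y=\varphi^\alpha-\sum_i\xi^iu^\alpha_i$; the characteristic system $\mathcal{S}^n_L$ of a finite-dimensional linear space $L$ of vector fields is the common zero set of all $D_KQ^\alpha_Y$, $|K|\le n-1$, $Y\in L$. A rectified PDE Lie algebra is a $p$-dimensional Abelian Lie algebra of $\pi^0_{-1}$-projectable vector fields whose projections span $T_xX$ at every $x$. A rectifiable PDE Lie algebra is a Lie algebra $L$ for which there is a rectified PDE Lie algebra $L'$ (an associated rectified PDE Lie algebra) with $\mathcal{S}^n_L=\mathcal{S}^n_{L'}$. A Lie algebra $L$ of vector fields is a Lie algebra of conditional symmetries of $\mathcal{S}_\Delta$ if $\mathbf{j}^nZ$ is tangent to $\mathcal{S}_\Delta\cap\mathcal{S}^n_L$ for every $Z\in L$. *)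

theory Defs
  imports "HOL-Analysis.Analysis"
begin

text \<open>Jet coordinates.  The independent variables are indexed by a finite type 'p
(so p = CARD('p)), the dependent ones by a finite type 'q (so q = CARD('q)).
A multi-index is a function K :: 'p \<Rightarrow> nat.  The coordinate Uc a K is u^a_K
(Uc a 0 is u^a).  A point of a jet space is an assignment of reals to all
coordinates; a function on J^m is a function of such points depending only on
the coordinates of order at most m.\<close>

datatype ('p, 'q) coord = Xc 'p | Uc 'q "'p \<Rightarrow> nat"

type_synonym ('p, 'q) jpt = "('p, 'q) coord \<Rightarrow> real"

definition mord :: "('p::finite \<Rightarrow> nat) \<Rightarrow> nat" where
  "mord K = (\<Sum>i\<in>UNIV. K i)"

fun cord :: "('p::finite, 'q) coord \<Rightarrow> nat" where
  "cord (Xc i) = 0"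
| "cord (Uc a K) = mord K"

definition zeroK :: "'p \<Rightarrow> nat" where "zeroK = (\<lambda>_. 0)"

definition unitK :: "'p \<Rightarrow> ('p \<Rightarrow> nat)" where
  "unitK i = (\<lambda>j. if j = i then 1 else 0)"

definition Kinc :: "('p \<Rightarrow> nat) \<Rightarrow> 'p \<Rightarrow> ('p \<Rightarrow> nat)" where
  "Kinc K i = K(i := Suc (K i))"

definition pd :: "('p, 'q) coord \<Rightarrow> (('p, 'q) jpt \<Rightarrow> real) \<Rightarrow> ('p, 'q) jpt \<Rightarrow> real" where
  "pd c F z = deriv (\<lambda>t. F (z(c := t))) (z c)"

fun ipd :: "('p, 'q) coord list \<Rightarrow> (('p, 'q) jpt \<Rightarrow> real) \<Rightarrow> ('p, 'q) jpt \<Rightarrow> real" where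
  "ipd [] F = F"
| "ipd (c # cs) F = pd c (ipd cs F)"

definition depends_upto :: "nat \<Rightarrow> (('p::finite, 'q) jpt \<Rightarrow> real) \<Rightarrow> bool" where
  "depends_upto m F \<longleftrightarrow> (\<forall>z w. (\<forall>c. cord c \<le> m \<longrightarrow> z c = w c) \<longrightarrow> F z = F w)"

definition jet_smooth_on :: "nat \<Rightarrow> ('p::finite, 'q) jpt set \<Rightarrow> (('p, 'q) jpt \<Rightarrow> real) \<Rightarrow> bool" where
  "jet_smooth_on m S F \<longleftrightarrow> depends_upto m F \<and>
     (\<forall>cs. (\<forall>c\<in>set cs. cord c \<le> m) \<longrightarrow>
        continuous_on S (ipd cs F) \<and>
        (\<forall>z\<in>S. \<forall>c. cord c \<le> m \<longrightarrow> (\<lambda>t. ipd cs F (z(c := t))) differentiable (at (z c))))"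

definition xpart :: "('p::finite, 'q) jpt \<Rightarrow> real ^ 'p" where
  "xpart z = (\<chi> i. z (Xc i))"

definition upart :: "('p::finite, 'q::finite) jpt \<Rightarrow> real ^ 'q" where
  "upart z = (\<chi> a. z (Uc a zeroK))"

definition Jdom :: "(real ^ 'p::finite) set \<Rightarrow> (real ^ 'q::finite) set \<Rightarrow> ('p, 'q) jpt set" where
  "Jdom X U = {z. xpart z \<in> X \<and> upart z \<in> U}"

text \<open>Vector fields on X \<times> U: (\<xi>, \<phi>) standing for \<Sum>\<xi>^i \<partial>_{x^i} + \<Sum>\<phi>^a \<partial>_{u^a}; the coefficients
are functions of order-0 coordinates.\<close>
type_synonym ('p, 'q) vf = "('p \<Rightarrow> ('p, 'q) jpt \<Rightarrow> real) \<times> ('q \<Rightarrow> ('p, 'q) jpt \<Rightarrow> real)"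

definition is_vf :: "(real ^ 'p::finite) set \<Rightarrow> (real ^ 'q::finite) set \<Rightarrow> ('p, 'q) vf \<Rightarrow> bool" where
  "is_vf X U Y \<longleftrightarrow> (\<forall>i. jet_smooth_on 0 (Jdom X U) (fst Y i)) \<and> (\<forall>a. jet_smooth_on 0 (Jdom X U) (snd Y a))"

definition base_apply :: "('p::finite, 'q::finite) vf \<Rightarrow> (('p, 'q) jpt \<Rightarrow> real) \<Rightarrow> ('p, 'q) jpt \<Rightarrow> real" where
  "base_apply Y f z = (\<Sum>i\<in>UNIV. fst Y i z * pd (Xc i) f z) + (\<Sum>a\<in>UNIV. snd Y a z * pd (Uc a zeroK) f z)"

definition vf_bracket :: "('p::finite, 'q::finite) vf \<Rightarrow> ('p, 'q) vf \<Rightarrow> ('p, 'q) vf" where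
  "vf_bracket Y1 Y2 =
     ((\<lambda>i z. base_apply Y1 (fst Y2 i) z - base_apply Y2 (fst Y1 i) z),
      (\<lambda>a z. base_apply Y1 (snd Y2 a) z - base_apply Y2 (snd Y1 a) z))"

definition vf_zero :: "('p, 'q) vf" where "vf_zero = ((\<lambda>i z. 0), (\<lambda>a z. 0))"

definition vf_lin :: "real \<Rightarrow> ('p, 'q) vf \<Rightarrow> real \<Rightarrow> ('p, 'q) vf \<Rightarrow> ('p, 'q) vf" where
  "vf_lin a Y1 b Y2 = ((\<lambda>i z. a * fst Y1 i z + b * fst Y2 i z), (\<lambda>j z. a * snd Y1 j z + b * snd Y2 j z))"

definition vf_comb :: "(('p, 'q) vf \<Rightarrow> real) \<Rightarrow> ('p, 'q) vf set \<Rightarrow> ('p, 'q) vf" where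
  "vf_comb c B = ((\<lambda>i z. \<Sum>b\<in>B. c b * fst b i z), (\<lambda>a z. \<Sum>b\<in>B. c b * snd b a z))"

definition vf_eq_on :: "('p, 'q) jpt set \<Rightarrow> ('p, 'q) vf \<Rightarrow> ('p, 'q) vf \<Rightarrow> bool" where
  "vf_eq_on S Y1 Y2 \<longleftrightarrow> (\<forall>z\<in>S. (\<forall>i. fst Y1 i z = fst Y2 i z) \<and> (\<forall>a. snd Y1 a z = snd Y2 a z))"

definition vf_lie_algebra :: "(real ^ 'p::finite) set \<Rightarrow> (real ^ 'q::finite) set \<Rightarrow> ('p, 'q) vf set \<Rightarrow> bool" where
  "vf_lie_algebra X U L \<longleftrightarrow>
     (\<forall>Y\<in>L. is_vf X U Y) \<and>
     (\<forall>Y1\<in>L. \<forall>Y2\<in>L. \<forall>a b. \<exists>Y\<in>L. vf_eq_on (Jdom X U) Y (vf_lin a Y1 b Y2)) \<and>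
     (\<exists>B. finite B \<and> B \<subseteq> L \<and> (\<forall>Y\<in>L. \<exists>c. vf_eq_on (Jdom X U) Y (vf_comb c B))) \<and>
     (\<forall>Y1\<in>L. \<forall>Y2\<in>L. \<exists>Y\<in>L. vf_eq_on (Jdom X U) Y (vf_bracket Y1 Y2))"

definition vf_dim :: "(real ^ 'p::finite) set \<Rightarrow> (real ^ 'q::finite) set \<Rightarrow> ('p, 'q) vf set \<Rightarrow> nat \<Rightarrow> bool" where
  "vf_dim X U L d \<longleftrightarrow> (\<exists>B. finite B \<and> B \<subseteq> L \<and> card B = d \<and>
     (\<forall>Y\<in>L. \<exists>c. vf_eq_on (Jdom X U) Y (vf_comb c B)) \<and>
     (\<forall>c. vf_eq_on (Jdom X U) (vf_comb c B) vf_zero \<longrightarrow> (\<forall>b\<in>B. c b = 0)))"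

definition projectable :: "(real ^ 'p::finite) set \<Rightarrow> (real ^ 'q::finite) set \<Rightarrow> ('p, 'q) vf \<Rightarrow> bool" where
  "projectable X U Y \<longleftrightarrow> (\<forall>i. \<forall>z\<in>Jdom X U. \<forall>w\<in>Jdom X U. xpart z = xpart w \<longrightarrow> fst Y i z = fst Y i w)"

definition rectified_pde_lie_algebra :: "(real ^ 'p::finite) set \<Rightarrow> (real ^ 'q::finite) set \<Rightarrow> ('p, 'q) vf set \<Rightarrow> bool" where
  "rectified_pde_lie_algebra X U L \<longleftrightarrow>
     vf_lie_algebra X U L \<and> vf_dim X U L CARD('p) \<and>
     (\<forall>Y1\<in>L. \<forall>Y2\<in>L. vf_eq_on (Jdom X U) (vf_bracket Y1 Y2) vf_zero) \<and>
     (\<forall>Y\<in>L. projectable X U Y) \<and>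
     (\<forall>z\<in>Jdom X U. \<forall>v :: 'p \<Rightarrow> real. \<exists>Y\<in>L. \<forall>i. fst Y i z = v i)"

definition Qchar :: "('p::finite, 'q) vf \<Rightarrow> 'q \<Rightarrow> ('p, 'q) jpt \<Rightarrow> real" where
  "Qchar Y a z = snd Y a z - (\<Sum>i\<in>UNIV. fst Y i z * z (Uc a (unitK i)))"

definition Dtot :: "nat \<Rightarrow> 'p::finite \<Rightarrow> (('p, 'q::finite) jpt \<Rightarrow> real) \<Rightarrow> ('p, 'q) jpt \<Rightarrow> real" where
  "Dtot m i F z = pd (Xc i) F z +
     (\<Sum>a\<in>UNIV. \<Sum>K\<in>{K. mord K \<le> m}. z (Uc a (Kinc K i)) * pd (Uc a K) F z)"

fun Dlist :: "'p::finite list \<Rightarrow> nat \<Rightarrow> (('p, 'q::finite) jpt \<Rightarrow> real) \<Rightarrow> ('p, 'q) jpt \<Rightarrow> real" where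
  "Dlist [] m F = F"
| "Dlist (i # is) m F = Dtot (m + length is) i (Dlist is m F)"

definition klist :: "('p::{finite,linorder} \<Rightarrow> nat) \<Rightarrow> 'p list" where
  "klist K = concat (map (\<lambda>i. replicate (K i) i) (sorted_list_of_set UNIV))"

definition DK :: "nat \<Rightarrow> ('p::{finite,linorder} \<Rightarrow> nat) \<Rightarrow> (('p, 'q::finite) jpt \<Rightarrow> real) \<Rightarrow> ('p, 'q) jpt \<Rightarrow> real" where
  "DK m K F = Dlist (klist K) m F"

definition char_sys :: "nat \<Rightarrow> (real ^ 'p::{finite,linorder}) set \<Rightarrow> (real ^ 'q::finite) set \<Rightarrow> ('p, 'q) vf set \<Rightarrow> ('p, 'q) jpt set" where
  "char_sys n X U L = {z \<in> Jdom X U. \<forall>Y\<in>L. \<forall>a K. mord K \<le> n - 1 \<longrightarrow> DK 1 K (Qchar Y a) z = 0}"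

definition prolong :: "nat \<Rightarrow> ('p::{finite,linorder}, 'q::finite) vf \<Rightarrow> ('p, 'q) jpt \<Rightarrow> ('p, 'q) jpt" where
  "prolong n Y z c = (case c of
       Xc i \<Rightarrow> fst Y i z
     | Uc a K \<Rightarrow> (if mord K \<le> n
                  then DK 1 K (Qchar Y a) z + (\<Sum>i\<in>UNIV. fst Y i z * z (Uc a (Kinc K i)))
                  else 0))"

definition jvf_apply :: "nat \<Rightarrow> (('p::finite, 'q::finite) jpt \<Rightarrow> ('p, 'q) jpt) \<Rightarrow> (('p, 'q) jpt \<Rightarrow> real) \<Rightarrow> ('p, 'q) jpt \<Rightarrow> real" where
  "jvf_apply n V F z = (\<Sum>i\<in>UNIV. V z (Xc i) * pd (Xc i) F z) +
     (\<Sum>a\<in>UNIV. \<Sum>K\<in>{K. mord K \<le> n}. V z (Uc a K) * pd (Uc a K) F z)"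

definition tangent_to :: "(('p, 'q) jpt \<Rightarrow> ('p, 'q) jpt) \<Rightarrow> ('p, 'q) jpt set \<Rightarrow> bool" where
  "tangent_to V S \<longleftrightarrow> (\<forall>z\<in>S. \<exists>\<gamma> \<epsilon>. \<epsilon> > 0 \<and> \<gamma> 0 = z \<and> (\<forall>t. \<bar>t\<bar> < \<epsilon> \<longrightarrow> \<gamma> t \<in> S) \<and>
       (\<forall>c. ((\<lambda>t. \<gamma> t c) has_real_derivative V z c) (at 0)))"

definition S_Delta :: "(real ^ 'p::finite) set \<Rightarrow> (real ^ 'q::finite) set \<Rightarrow> nat \<Rightarrow> (nat \<Rightarrow> ('p, 'q) jpt \<Rightarrow> real) \<Rightarrow> ('p, 'q) jpt set" where
  "S_Delta X U s \<Delta> = {z \<in> Jdom X U. \<forall>\<mu><s. \<Delta> \<mu> z = 0}"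

end

theory Submission
  imports Defs
begin

text \<open>Since the bracket of Z_i and Z_j vanishes, these fields commute as operators on functions of
(x, u), so that sec(x, u) with u^a_K = Z^K u^a is well defined and satisfies
(D_i F)(sec) = Z_i (F(sec)) for every F on a jet space.  Hence the characteristic system of L' is the
set of jets agreeing with sec up to order n, a graph over X \<times> U.  Evaluating the characteristics of
Y \<in> L (the case K = 0) on this graph gives Y = \<Sum>\<xi>^k Z_k, and then D_K Q_Y = 0 along sec for all K.
The order |K| + 1 terms of D_K Q_Y cancel in the prolongation, which therefore takes the value
\<Sum>\<xi>^k Z_k(sec_K) = Y(sec_K) at K: it is the push-forward of Y along the graph.\<close>

subsection \<open>Calculus on open sets of jets\<close>

text \<open>A jet point has infinitely many coordinates and the space of jet points carries only the
  product topology: there is no norm and no Frechet derivative, and smoothness means existence and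
  continuity of iterated partial derivatives. The chain rule and the symmetry of mixed partials are
  therefore derived from the one-variable mean value theorem. This works because open sets constrain
  finitely many coordinates and every function involved has finite order. The cancellation of the
  top-order terms is essential: for |K| = n the prolongation contains coordinates of order n + 1,
  and D_K Q_Y is not among the equations of the system, which stop at |K| = n - 1, so neither
  summand alone is controlled at a point of the system. The condition obtained from Y at K = 0 holds
  over the whole open set X \<times> U, since every base point carries a point of the graph. An
  identity on an open set may be differentiated along the Z_k, and this is how every K is
  reached.\<close>

lemma open_jpt_box:
  fixes W :: "('a \<Rightarrow> real) set"
  assumes "open W" "z \<in> W"
  obtains I e where "finite I" "e > 0" "\<And>y. (\<And>i. i \<in> I \<Longrightarrow> \<bar>y i - z i\<bar> < e) \<Longrightarrow> y \<in> W"
proof -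
  have "openin (product_topology (\<lambda>i. euclidean) UNIV) W"
    using assms(1) by (simp add: open_fun_def)
  from product_topology_open_contains_basis[OF this assms(2)]
  obtain B where B: "z \<in> (\<Pi>\<^sub>E i\<in>UNIV. B i)" "\<And>i. open (B i)"
      "finite {i. B i \<noteq> UNIV}" "(\<Pi>\<^sub>E i\<in>UNIV. B i) \<subseteq> W"
    by auto
  define I where "I = {i. B i \<noteq> UNIV}"
  have "\<exists>d>0. \<forall>x. \<bar>x - z i\<bar> < d \<longrightarrow> x \<in> B i" for i
  proof -
    have "z i \<in> B i" using B(1) by auto
    then show ?thesis
      using B(2)[of i] by (auto simp: open_dist dist_real_def)
  qed
  then obtain d where d: "\<And>i. d i > 0" "\<And>i x. \<bar>x - z i\<bar> < d i \<Longrightarrow> x \<in> B i"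
    by metis
  define e where "e = Min (insert 1 (d ` I))"
  have fI: "finite I" using B(3) by (simp add: I_def)
  have "e > 0" unfolding e_def using fI d by (subst Min_gr_iff) auto
  moreover have "y \<in> W" if y: "\<And>i. i \<in> I \<Longrightarrow> \<bar>y i - z i\<bar> < e" for y
  proof -
    have "y i \<in> B i" for i
    proof (cases "i \<in> I")
      case True
      then have "e \<le> d i" unfolding e_def using fI by (intro Min_le) auto
      then show ?thesis using y[OF True] d(2)[of "y i" i] by simp
    next
      case False
      then show ?thesis by (simp add: I_def)
    qed
    then show ?thesis using B(4) by auto
  qed
  ultimately show ?thesis using that fI by blast
qed

lemma tendsto_fun_upd:
  fixes z :: "'a \<Rightarrow> real"
  shows "((\<lambda>t. z(c := t)) \<longlongrightarrow> z) (nhds (z c))"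
proof (rule topological_tendstoI)
  fix S assume "open S" "z \<in> S"
  then obtain I e where I: "finite I" "e > 0" "\<And>y. (\<And>i. i \<in> I \<Longrightarrow> \<bar>y i - z i\<bar> < e) \<Longrightarrow> y \<in> S"
    using open_jpt_box by blast
  have "\<forall>\<^sub>F t in nhds (z c). dist t (z c) < e"
    using I(2) eventually_nhds_metric by blast
  then show "\<forall>\<^sub>F t in nhds (z c). z(c := t) \<in> S"
    by eventually_elim (use I in \<open>auto simp: dist_real_def\<close>)
qed

lemma eventually_fun_upd_mem:
  fixes W :: "('a \<Rightarrow> real) set"
  assumes "open W" "z \<in> W"
  shows "\<forall>\<^sub>F t in nhds (z c). z(c := t) \<in> W"
  using topological_tendstoD[OF tendsto_fun_upd assms] .

lemma pd_cong:
  assumes "open W" "z \<in> W" "\<And>w. w \<in> W \<Longrightarrow> F w = G w"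
  shows "pd c F z = pd c G z"
  unfolding pd_def
  by (intro deriv_cong_ev eventually_mono[OF eventually_fun_upd_mem[OF assms(1,2)]] assms(3)) auto

definition partially_diff :: "('p, 'q) jpt set \<Rightarrow> (('p, 'q) jpt \<Rightarrow> real) \<Rightarrow> bool" where
  "partially_diff W F \<longleftrightarrow> continuous_on W F \<and>
     (\<forall>z\<in>W. \<forall>c. (\<lambda>t. F (z(c := t))) differentiable (at (z c)))"

text \<open>This is not quite the usual C^k: the partials up to order k are continuous and also
  differentiable in each coordinate. So \<open>ck_on 1\<close> contains the continuous first
  partials that \<open>chain_rule_aux\<close> needs. Recursion on k, instead of coordinate lists as
  in \<open>ipd\<close>, makes closure under sums and products an induction.\<close>

primrec ck_on :: "nat \<Rightarrow> ('p, 'q) jpt set \<Rightarrow> (('p, 'q) jpt \<Rightarrow> real) \<Rightarrow> bool" where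
  "ck_on 0 W F \<longleftrightarrow> partially_diff W F"
| "ck_on (Suc k) W F \<longleftrightarrow> partially_diff W F \<and> (\<forall>c. ck_on k W (pd c F))"

definition csmooth_on :: "('p, 'q) jpt set \<Rightarrow> (('p, 'q) jpt \<Rightarrow> real) \<Rightarrow> bool" where
  "csmooth_on W F \<longleftrightarrow> (\<forall>k. ck_on k W F)"

lemma ck_on_imp_partially_diff: "ck_on k W F \<Longrightarrow> partially_diff W F"
  by (cases k) auto

lemma ck_on_SucD: "ck_on (Suc k) W F \<Longrightarrow> ck_on k W F"
  by (induction k arbitrary: F) auto

lemma csmooth_imp_partially_diff: "csmooth_on W F \<Longrightarrow> partially_diff W F"
  using ck_on_imp_partially_diff unfolding csmooth_on_def by blast

lemma csmooth_pd: "csmooth_on W F \<Longrightarrow> csmooth_on W (pd c F)"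
  unfolding csmooth_on_def by (metis ck_on.simps(2))

lemma csmooth_cont: "csmooth_on W F \<Longrightarrow> continuous_on W F"
  using csmooth_imp_partially_diff unfolding partially_diff_def by blast

lemma partially_diff_pd:
  assumes "partially_diff W F" "z \<in> W"
  shows "((\<lambda>t. F (z(c := t))) has_real_derivative pd c F z) (at (z c))"
  using assms unfolding partially_diff_def pd_def
  by (metis DERIV_deriv_iff_real_differentiable)

lemma partially_diff_pd':
  assumes "partially_diff W F" "z(c := s) \<in> W"
  shows "((\<lambda>t. F (z(c := t))) has_real_derivative pd c F (z(c := s))) (at s)"
  using partially_diff_pd[OF assms, of c] by simp

lemma pd_eqI:
  assumes "((\<lambda>t. F (z(c := t))) has_real_derivative D) (at (z c))"
  shows "pd c F z = D"
  unfolding pd_def using assms by (rule DERIV_imp_deriv)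

lemma partially_diff_cong:
  assumes "open W" "\<And>w. w \<in> W \<Longrightarrow> F w = G w"
  shows "partially_diff W F \<longleftrightarrow> partially_diff W G"
proof -
  have "partially_diff W G" if F: "partially_diff W F" and eq: "\<And>w. w \<in> W \<Longrightarrow> F w = G w" for F G
    unfolding partially_diff_def
  proof (intro conjI ballI allI)
    show "continuous_on W G"
      using F eq continuous_on_cong[of W W F G] unfolding partially_diff_def by simp
    fix z c assume z: "z \<in> W"
    have "((\<lambda>t. F (z(c := t))) has_real_derivative pd c F z) (at (z c))"
      using partially_diff_pd[OF F z] .
    moreover have "\<forall>\<^sub>F t in nhds (z c). F (z(c := t)) = G (z(c := t))"
      using eventually_fun_upd_mem[OF assms(1) z] by eventually_elim (use eq in auto)
    ultimately have "((\<lambda>t. G (z(c := t))) has_real_derivative pd c F z) (at (z c))"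
      using DERIV_cong_ev[OF refl _ refl] by metis
    then show "(\<lambda>t. G (z(c := t))) differentiable (at (z c))"
      using real_differentiable_def by blast
  qed
  from this[of F G] this[of G F] show ?thesis using assms(2) by auto
qed

text \<open>The sum and product rules for \<open>pd\<close> are available only at points of W;
  elsewhere the derivative of a product may differ from its Leibniz expression. This lemma allows
  one to replace the other under \<open>ck_on\<close>.\<close>

lemma ck_on_cong:
  assumes "open W" "\<And>w. w \<in> W \<Longrightarrow> F w = G w"
  shows "ck_on k W F \<longleftrightarrow> ck_on k W G"
  using assms(2)
proof (induction k arbitrary: F G)
  case 0
  then show ?case using partially_diff_cong[OF assms(1), of F G] by simp
next
  case (Suc k)
  have "ck_on k W (pd c F) = ck_on k W (pd c G)" for c
    by (intro Suc.IH pd_cong[OF assms(1)] Suc.prems)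
  then show ?case using partially_diff_cong[OF assms(1), of F G] Suc.prems by simp
qed

lemma pd_const [simp]: "pd c (\<lambda>_. k) = (\<lambda>_. 0)"
  by (rule ext, rule pd_eqI) auto

lemma partially_diff_const [simp]: "partially_diff W (\<lambda>_. k)"
  unfolding partially_diff_def by auto

lemma ck_on_const [simp]: "ck_on k W (\<lambda>_. d)"
  by (induction k arbitrary: d) auto

lemma csmooth_const [simp]: "csmooth_on W (\<lambda>_. d)"
  unfolding csmooth_on_def by simp

lemma pd_coord: "pd c (\<lambda>z. z d) = (\<lambda>z. if c = d then 1 else 0)"
  by (rule ext, rule pd_eqI) auto

lemma csmooth_coord [simp]: "csmooth_on W (\<lambda>z. z d)"
proof -
  have "partially_diff W (\<lambda>z. z d)"
    unfolding partially_diff_def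
  proof (intro conjI ballI allI)
    show "continuous_on W (\<lambda>z. z d)"
      by (auto intro: continuous_on_subset[OF continuous_on_product_coordinates])
    show "(\<lambda>t. (z(c := t)) d) differentiable (at (z c))" for z :: "('a, 'b) jpt" and c
      by (cases "c = d") auto
  qed
  then have "ck_on k W (\<lambda>z. z d)" for k
    by (cases k) (auto simp: pd_coord)
  then show ?thesis unfolding csmooth_on_def by simp
qed

lemma partially_diff_add:
  assumes "partially_diff W F" "partially_diff W G"
  shows "partially_diff W (\<lambda>z. F z + G z)"
  using assms unfolding partially_diff_def
  by (auto intro!: continuous_intros derivative_intros)

lemma pd_add:
  assumes "partially_diff W F" "partially_diff W G" "z \<in> W"
  shows "pd c (\<lambda>z. F z + G z) z = pd c F z + pd c G z"
  by (intro pd_eqI DERIV_add partially_diff_pd[OF _ assms(3)] assms)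

lemma partially_diff_mult:
  assumes "partially_diff W F" "partially_diff W G"
  shows "partially_diff W (\<lambda>z. F z * G z)"
  using assms unfolding partially_diff_def
  by (auto intro!: continuous_intros derivative_intros)

lemma pd_mult:
  assumes "partially_diff W F" "partially_diff W G" "z \<in> W"
  shows "pd c (\<lambda>z. F z * G z) z = pd c F z * G z + F z * pd c G z"
proof (rule pd_eqI)
  show "((\<lambda>t. F (z(c := t)) * G (z(c := t))) has_real_derivative pd c F z * G z + F z * pd c G z) (at (z c))"
    using DERIV_mult[OF partially_diff_pd[OF assms(1,3), of c] partially_diff_pd[OF assms(2,3), of c]]
    by (simp add: algebra_simps)
qed

lemma ck_on_add:
  assumes "open W" "ck_on k W F" "ck_on k W G"
  shows "ck_on k W (\<lambda>z. F z + G z)"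
  using assms(2,3)
proof (induction k arbitrary: F G)
  case (Suc k)
  have "ck_on k W (pd c (\<lambda>z. F z + G z))" for c
  proof -
    have "ck_on k W (\<lambda>z. pd c F z + pd c G z)"
      using Suc by auto
    then show ?thesis
      by (subst ck_on_cong[OF assms(1), of _ "\<lambda>z. pd c F z + pd c G z"])
        (use Suc.prems in \<open>auto intro: pd_add\<close>)
  qed
  then show ?case using Suc.prems partially_diff_add by auto
qed (auto intro: partially_diff_add)

lemma ck_on_mult:
  assumes "open W" "ck_on k W F" "ck_on k W G"
  shows "ck_on k W (\<lambda>z. F z * G z)"
  using assms(2,3)
proof (induction k arbitrary: F G)
  case (Suc k)
  have "ck_on k W (pd c (\<lambda>z. F z * G z))" for c
  proof -
    have "ck_on k W (\<lambda>z. pd c F z * G z)" "ck_on k W (\<lambda>z. F z * pd c G z)"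
      using Suc.IH Suc.prems ck_on_SucD[OF Suc.prems(1)] ck_on_SucD[OF Suc.prems(2)] by auto
    then have "ck_on k W (\<lambda>z. pd c F z * G z + F z * pd c G z)"
      using ck_on_add[OF assms(1)] by blast
    then show ?thesis
      by (subst ck_on_cong[OF assms(1), of _ "\<lambda>z. pd c F z * G z + F z * pd c G z"])
        (use Suc.prems in \<open>auto intro: pd_mult\<close>)
  qed
  then show ?case using Suc.prems partially_diff_mult by auto
qed (auto intro: partially_diff_mult)

lemma csmooth_add:
  "open W \<Longrightarrow> csmooth_on W F \<Longrightarrow> csmooth_on W G \<Longrightarrow> csmooth_on W (\<lambda>z. F z + G z)"
  unfolding csmooth_on_def using ck_on_add by blast

lemma csmooth_mult:
  "open W \<Longrightarrow> csmooth_on W F \<Longrightarrow> csmooth_on W G \<Longrightarrow> csmooth_on W (\<lambda>z. F z * G z)"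
  unfolding csmooth_on_def using ck_on_mult by blast

lemma csmooth_minus:
  "open W \<Longrightarrow> csmooth_on W F \<Longrightarrow> csmooth_on W G \<Longrightarrow> csmooth_on W (\<lambda>z. F z - G z)"
  using csmooth_add[of W F "\<lambda>z. -1 * G z"] csmooth_mult[of W "\<lambda>_. -1" G] by simp

lemma csmooth_sum:
  "open W \<Longrightarrow> (\<And>a. a \<in> A \<Longrightarrow> csmooth_on W (F a)) \<Longrightarrow> csmooth_on W (\<lambda>z. \<Sum>a\<in>A. F a z)"
  by (induction A rule: infinite_finite_induct) (auto intro: csmooth_add)

lemma pd_csmooth_minus:
  assumes "open W" "csmooth_on W F" "csmooth_on W G" "z \<in> W"
  shows "pd c (\<lambda>z. F z - G z) z = pd c F z - pd c G z"
  by (intro pd_eqI DERIV_diff partially_diff_pd[OF _ assms(4)] csmooth_imp_partially_diff assms)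

lemma pd_csmooth_mult:
  assumes "csmooth_on W F" "csmooth_on W G" "z \<in> W"
  shows "pd c (\<lambda>z. F z * G z) z = pd c F z * G z + F z * pd c G z"
  by (rule pd_mult[OF _ _ assms(3)]) (auto intro: csmooth_imp_partially_diff assms)

lemma pd_csmooth_sum:
  assumes "open W" "\<And>a. a \<in> A \<Longrightarrow> csmooth_on W (F a)" "z \<in> W"
  shows "pd c (\<lambda>z. \<Sum>a\<in>A. F a z) z = (\<Sum>a\<in>A. pd c (F a) z)"
  by (intro pd_eqI DERIV_sum partially_diff_pd[OF _ assms(3)] csmooth_imp_partially_diff assms(2))

section \<open>Functions of finite order\<close>

lemma depends_upto_mono: "depends_upto m F \<Longrightarrow> m \<le> k \<Longrightarrow> depends_upto k F"
  unfolding depends_upto_def by (meson order.trans)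

lemma pd_eq_0:
  assumes "depends_upto m F" "m < cord c"
  shows "pd c F = (\<lambda>_. 0)"
proof (rule ext, rule pd_eqI)
  fix z
  have "F (z(c := t)) = F z" for t
    using assms unfolding depends_upto_def by (metis fun_upd_apply leD)
  then show "((\<lambda>t. F (z(c := t))) has_real_derivative 0) (at (z c))" by simp
qed

lemma depends_upto_pd:
  assumes "depends_upto m F"
  shows "depends_upto m (pd c F)"
proof (cases "cord c \<le> m")
  case True
  show ?thesis unfolding depends_upto_def
  proof (intro allI impI)
    fix z w :: "('a, 'b) jpt"
    assume *: "\<forall>c. cord c \<le> m \<longrightarrow> z c = w c"
    have "F (z(c := t)) = F (w(c := t))" for t
      by (rule assms[unfolded depends_upto_def, rule_format]) (use * in auto)
    moreover have "z c = w c" using True * by blast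
    ultimately show "pd c F z = pd c F w" unfolding pd_def by simp
  qed
next
  case False
  then show ?thesis using pd_eq_0[OF assms, of c] by (simp add: depends_upto_def)
qed

lemma jet_smooth_imp_csmooth:
  assumes "jet_smooth_on m W F"
  shows "csmooth_on W F"
proof -
  have dep: "depends_upto m F" using assms unfolding jet_smooth_on_def by blast
  have depi: "depends_upto m (ipd cs F)" for cs
    by (induction cs) (auto intro: dep depends_upto_pd)
  have z: "ipd cs F = (\<lambda>_. 0)" if "c \<in> set cs" "m < cord c" for cs c
    using that
  proof (induction cs)
    case (Cons d cs)
    show ?case
    proof (cases "d = c")
      case True
      then show ?thesis using pd_eq_0[OF depi[of cs] Cons.prems(2)] by auto
    next
      case False
      then show ?thesis using Cons by simp
    qed
  qed simp
  have pdiff: "partially_diff W (ipd cs F)" for cs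
  proof (cases "\<forall>c\<in>set cs. cord c \<le> m")
    case True
    then have *: "continuous_on W (ipd cs F)" 
      "\<forall>z\<in>W. \<forall>c. cord c \<le> m \<longrightarrow> (\<lambda>t. ipd cs F (z(c := t))) differentiable (at (z c))"
      using assms unfolding jet_smooth_on_def by blast+
    have "(\<lambda>t. ipd cs F (z(c := t))) differentiable (at (z c))" if "m < cord c" for c z
    proof -
      have "ipd cs F (z(c := t)) = ipd cs F z" for t
        using depi[of cs] that unfolding depends_upto_def by (metis fun_upd_apply leD)
      then show ?thesis by simp
    qed
    with * show ?thesis unfolding partially_diff_def by (meson not_le)
  next
    case False
    then show ?thesis using z[of _ cs] by (metis not_le partially_diff_const)
  qed
  have "ck_on k W (ipd cs F)" for k cs
    by (induction k arbitrary: cs) (auto simp: pdiff simp flip: ipd.simps)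
  from this[of _ "[]"] show ?thesis unfolding csmooth_on_def by simp
qed

section \<open>Mean value theorem and chain rule for finitely many moving coordinates\<close>

lemma partially_diff_mvt:
  assumes "partially_diff W F"
    and seg: "\<And>s. \<bar>s - a\<bar> \<le> \<bar>b - a\<bar> \<Longrightarrow> y(c := s) \<in> W"
  shows "\<exists>\<theta>. \<bar>\<theta> - a\<bar> \<le> \<bar>b - a\<bar> \<and> F (y(c := b)) - F (y(c := a)) = (b - a) * pd c F (y(c := \<theta>))"
proof -
  have D: "((\<lambda>t. F (y(c := t))) has_real_derivative pd c F (y(c := s))) (at s)" 
    if "\<bar>s - a\<bar> \<le> \<bar>b - a\<bar>" for s
    using partially_diff_pd'[OF assms(1) seg[OF that]] .
  consider "a = b" | "a < b" | "b < a" by linarith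
  then show ?thesis
  proof cases
    case 1 then show ?thesis by auto
  next
    case 2
    have "\<exists>x>a. x < b \<and> F (y(c := b)) - F (y(c := a)) = (b - a) * pd c F (y(c := x))"
      by (rule MVT2[OF 2, where f = "\<lambda>t. F (y(c := t))"]) (rule D, use 2 in auto)
    then show ?thesis by force
  next
    case 3
    have "\<exists>x>b. x < a \<and> F (y(c := a)) - F (y(c := b)) = (a - b) * pd c F (y(c := x))"
      by (rule MVT2[OF 3, where f = "\<lambda>t. F (y(c := t))"]) (rule D, use 3 in auto)
    then obtain x where "x > b" "x < a" "F (y(c := a)) - F (y(c := b)) = (a - b) * pd c F (y(c := x))" by blast
    then show ?thesis by (intro exI[of _ x]) (auto simp: algebra_simps)
  qed
qed

text \<open>The coordinates in A move, the others are frozen at z. Adding d to A changes F by a mean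
  value increment in direction d; divided by t - t0 it tends to \<open>v d * pd d F z\<close>,
  because the intermediate point tends to z and \<open>pd d F\<close> is continuous. Induction on A
  thus replaces total differentiability.\<close>

lemma chain_rule_aux:
  fixes z :: "('p, 'q) jpt"
  assumes W: "open W" "z \<in> W" and F: "ck_on 1 W F" and fin: "finite A"
    and \<gamma>: "\<And>c. c \<in> A \<Longrightarrow> ((\<lambda>t. \<gamma> t c) has_real_derivative v c) (at t0)"
    and \<gamma>0: "\<And>c. c \<in> A \<Longrightarrow> \<gamma> t0 c = z c"
  shows "((\<lambda>t. F (\<lambda>c. if c \<in> A then \<gamma> t c else z c)) has_real_derivative
           (\<Sum>c\<in>A. v c * pd c F z)) (at t0)"
  using fin \<gamma> \<gamma>0
proof (induction A rule: finite_induct)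
  case empty
  then show ?case by simp
next
  case (insert d B)
  define y where "y t = (\<lambda>c. if c \<in> B then \<gamma> t c else z c)" for t
  have yd: "y t d = z d" for t using insert.hyps by (simp add: y_def)
  have ins: "(\<lambda>c. if c \<in> insert d B then \<gamma> t c else z c) = (y t)(d := \<gamma> t d)" for t
    by (auto simp: y_def)
  have IH: "((\<lambda>t. F (y t)) has_real_derivative (\<Sum>c\<in>B. v c * pd c F z)) (at t0)"
    unfolding y_def using insert by auto
  have pdF: "partially_diff W F" and cont: "continuous_on W (pd d F)"
    using F by (auto simp: partially_diff_def)
  have t0: "\<gamma> t0 d = z d" and y0: "y t0 = z"
    using insert.prems(2) by (auto simp: y_def)
  \<comment> \<open>Used twice: with S = W it keeps the segment in direction d inside the domain of
    the mean value theorem, with arbitrary S it makes the intermediate point converge to z.\<close>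
  have near: "\<forall>\<^sub>F t in at t0. \<forall>s. \<bar>s - z d\<bar> \<le> \<bar>\<gamma> t d - z d\<bar> \<longrightarrow> (y t)(d := s) \<in> S" 
    if S: "open S" "z \<in> S" for S
  proof -
    obtain I e where I: "finite I" "e > 0" "\<And>y. (\<And>i. i \<in> I \<Longrightarrow> \<bar>y i - z i\<bar> < e) \<Longrightarrow> y \<in> S"
      using open_jpt_box[OF S] by blast
    have "\<forall>\<^sub>F t in at t0. \<bar>\<gamma> t c - z c\<bar> < e" if "c \<in> insert d B" for c
    proof -
      have "((\<lambda>t. \<gamma> t c) \<longlongrightarrow> \<gamma> t0 c) (at t0)"
        using insert.prems(1)[OF that] DERIV_isCont isCont_def by blast
      then show ?thesis using I(2) insert.prems(2)[OF that]
        by (auto simp: tendsto_iff dist_real_def)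
    qed
    then have "\<forall>\<^sub>F t in at t0. \<forall>c\<in>insert d B. \<bar>\<gamma> t c - z c\<bar> < e"
      using insert.hyps(1) by (intro eventually_ball_finite) auto
    then show ?thesis
    proof eventually_elim
      case (elim t)
      then show ?case using I(2) by (intro allI impI I(3)) (auto simp: y_def)
    qed
  qed
  have "\<forall>\<^sub>F t in at t0. \<exists>\<theta>. \<bar>\<theta> - z d\<bar> \<le> \<bar>\<gamma> t d - z d\<bar> \<and>
      F ((y t)(d := \<gamma> t d)) - F (y t) = (\<gamma> t d - z d) * pd d F ((y t)(d := \<theta>))"
    using near[OF W]
  proof eventually_elim
    case (elim t)
    from partially_diff_mvt[OF pdF, of "z d" "\<gamma> t d" "y t" d] elim
    show ?case using yd[of t] by (metis fun_upd_triv)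
  qed
  then obtain \<theta> where \<theta>: "\<forall>\<^sub>F t in at t0. \<bar>\<theta> t - z d\<bar> \<le> \<bar>\<gamma> t d - z d\<bar> \<and>
      F ((y t)(d := \<gamma> t d)) - F (y t) = (\<gamma> t d - z d) * pd d F ((y t)(d := \<theta> t))"
    unfolding eventually_ex by blast
  have lim: "((\<lambda>t. (y t)(d := \<theta> t)) \<longlongrightarrow> z) (at t0)"
  proof (rule topological_tendstoI)
    fix S assume "open S" "z \<in> S"
    from near[OF this] \<theta> show "\<forall>\<^sub>F t in at t0. (y t)(d := \<theta> t) \<in> S"
      by eventually_elim auto
  qed
  \<comment> \<open>The filter is \<open>nhds z\<close> and not a punctured one, since the
    intermediate point may coincide with z.\<close>
  have "((\<lambda>w. pd d F w) \<longlongrightarrow> pd d F z) (nhds z)"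
    using cont W unfolding continuous_on_def
    by (metis at_within_open tendsto_at_iff_tendsto_nhds)
  then have "((\<lambda>t. pd d F ((y t)(d := \<theta> t))) \<longlongrightarrow> pd d F z) (at t0)"
    using lim by (rule filterlim_compose)
  moreover have "((\<lambda>t. (\<gamma> t d - \<gamma> t0 d) / (t - t0)) \<longlongrightarrow> v d) (at t0)"
    using insert.prems(1)[of d] by (simp add: has_field_derivative_iff)
  ultimately have "((\<lambda>t. (\<gamma> t d - \<gamma> t0 d) / (t - t0) * pd d F ((y t)(d := \<theta> t))) \<longlongrightarrow> v d * pd d F z) (at t0)"
    by (intro tendsto_mult)
  then have "((\<lambda>t. ((F ((y t)(d := \<gamma> t d)) - F (y t)) - (F ((y t0)(d := \<gamma> t0 d)) - F (y t0))) / (t - t0)) \<longlongrightarrow> v d * pd d F z) (at t0)"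
    by (rule Lim_transform_eventually)
      (use \<theta> in eventually_elim, use t0 y0 in simp)
  then have "((\<lambda>t. F ((y t)(d := \<gamma> t d)) - F (y t)) has_real_derivative v d * pd d F z) (at t0)"
    by (simp add: has_field_derivative_iff)
  from DERIV_add[OF this IH] show ?case
    unfolding ins using insert.hyps by simp
qed

lemma finite_multi_index: "finite {K :: 'p::finite \<Rightarrow> nat. mord K \<le> m}"
proof (rule finite_subset)
  show "{K :: 'p \<Rightarrow> nat. mord K \<le> m} \<subseteq> (\<Pi>\<^sub>E i\<in>UNIV. {..m})"
  proof (rule subsetI)
    fix K :: "'p \<Rightarrow> nat" assume "K \<in> {K. mord K \<le> m}"
    moreover have "K i \<le> mord K" for i
      unfolding mord_def by (rule member_le_sum) auto
    ultimately show "K \<in> (\<Pi>\<^sub>E i\<in>UNIV. {..m})" by (auto intro: order.trans)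
  qed
  show "finite (\<Pi>\<^sub>E i\<in>(UNIV :: 'p set). {..m})"
    by (intro finite_PiE) auto
qed

lemma coords_upto_eq:
  "{c :: ('p::finite, 'q) coord. cord c \<le> m} = range Xc \<union> (\<lambda>(a, K). Uc a K) ` (UNIV \<times> {K. mord K \<le> m})"
proof -
  have "c \<in> range Xc \<union> (\<lambda>(a, K). Uc a K) ` (UNIV \<times> {K. mord K \<le> m}) \<longleftrightarrow> cord c \<le> m" for c :: "('p, 'q) coord"
    by (cases c) auto
  then show ?thesis by blast
qed

lemma finite_coords_upto: "finite {c :: ('p::finite, 'q::finite) coord. cord c \<le> m}"
  unfolding coords_upto_eq by (intro finite_UnI finite_imageI finite_cartesian_product finite_multi_index) auto

lemma sum_coords_upto:
  "(\<Sum>c | cord (c :: ('p::finite, 'q::finite) coord) \<le> m. f c) =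
     (\<Sum>i\<in>UNIV. f (Xc i)) + (\<Sum>a\<in>UNIV. \<Sum>K | mord K \<le> m. f (Uc a K))"
proof -
  have "(\<Sum>c | cord (c :: ('p, 'q) coord) \<le> m. f c) =
      (\<Sum>c\<in>range Xc. f c) + (\<Sum>c\<in>(\<lambda>(a, K). Uc a K) ` (UNIV \<times> {K. mord K \<le> m}). f c)"
    unfolding coords_upto_eq
    by (rule sum.union_disjoint) (auto intro!: finite_cartesian_product finite_multi_index)
  also have "(\<Sum>c\<in>range Xc. f c) = (\<Sum>i\<in>UNIV. f (Xc i))"
    by (subst sum.reindex) (auto simp: inj_on_def)
  also have "(\<Sum>c\<in>(\<lambda>(a, K). Uc a K) ` (UNIV \<times> {K. mord K \<le> m}). f c) = 
      (\<Sum>a\<in>UNIV. \<Sum>K | mord K \<le> m. f (Uc a K))"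
    by (subst sum.reindex) (auto simp: inj_on_def sum.cartesian_product split_def)
  finally show ?thesis .
qed

text \<open>F reads only the finitely many coordinates of order at most m, so those of higher order
  may move along the curve without having a derivative.\<close>

lemma chain_rule:
  fixes W :: "('p::finite, 'q::finite) jpt set"
  assumes W: "open W" "\<gamma> t0 \<in> W" and F: "csmooth_on W F" "depends_upto m F"
    and \<gamma>: "\<And>c. cord c \<le> m \<Longrightarrow> ((\<lambda>t. \<gamma> t c) has_real_derivative v c) (at t0)"
  shows "((\<lambda>t. F (\<gamma> t)) has_real_derivative (\<Sum>c | cord c \<le> m. v c * pd c F (\<gamma> t0))) (at t0)"
proof -
  have "((\<lambda>t. F (\<lambda>c. if c \<in> {c. cord c \<le> m} then \<gamma> t c else \<gamma> t0 c)) has_real_derivative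
           (\<Sum>c | cord c \<le> m. v c * pd c F (\<gamma> t0))) (at t0)"
    by (rule chain_rule_aux[where z = "\<gamma> t0", OF W _ finite_coords_upto])
      (use F(1) \<gamma> in \<open>simp_all add: csmooth_on_def del: ck_on.simps One_nat_def\<close>)
  moreover have "F (\<lambda>c. if c \<in> {c. cord c \<le> m} then \<gamma> t c else \<gamma> t0 c) = F (\<gamma> t)" for t
    using F(2) unfolding depends_upto_def by simp
  ultimately show ?thesis by simp
qed

section \<open>Symmetry of mixed partial derivatives\<close>

lemma second_difference_mvt:
  assumes S: "open S" "z \<in> S" and F: "ck_on 2 S F" and cd: "c \<noteq> d"
  shows "\<exists>e>0. \<forall>h. 0 < h \<and> h < e \<longrightarrow> (\<exists>w\<in>S.
    F (z(c := z c + h, d := z d + h)) - F (z(c := z c + h)) - F (z(d := z d + h)) + F z = h * h * pd d (pd c F) w)"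
proof -
  obtain I e where I: "finite I" "e > 0" "\<And>y. (\<And>i. i \<in> I \<Longrightarrow> \<bar>y i - z i\<bar> < e) \<Longrightarrow> y \<in> S"
    using open_jpt_box[OF S] by blast
  have F1: "partially_diff S F" "partially_diff S (pd c F)" 
    using F by (auto simp: numeral_2_eq_2)
  have "\<exists>w\<in>S. F (z(c := z c + h, d := z d + h)) - F (z(c := z c + h)) - F (z(d := z d + h)) + F z = h * h * pd d (pd c F) w" 
    if h: "0 < h" "h < e" for h
  proof -
    have mem: "z(c := s, d := t) \<in> S" if "\<bar>s - z c\<bar> < e" "\<bar>t - z d\<bar> < e" for s t
      using that I(2) by (intro I(3)) auto
    \<comment> \<open>The second difference over the square is the increment of g in direction c. A
      further mean value step, in direction d, turns it into a mixed partial at a point of the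
      square.\<close>
    define g where "g s = F (z(d := z d + h, c := s)) - F (z(c := s))" for s
    have z0: "z(c := s) = z(c := s, d := z d)" for s
      using cd by (auto simp: fun_eq_iff)
    have "\<exists>s>z c. s < z c + h \<and> g (z c + h) - g (z c) = 
       (z c + h - z c) * (pd c F (z(d := z d + h, c := s)) - pd c F (z(c := s)))"
    proof (rule MVT2)
      show "z c < z c + h" using h by simp
      fix s assume s: "z c \<le> s" "s \<le> z c + h"
      show "DERIV g s :> pd c F (z(d := z d + h, c := s)) - pd c F (z(c := s))"
        unfolding g_def
      proof (intro DERIV_diff partially_diff_pd'[OF F1(1)])
        show "z(d := z d + h, c := s) \<in> S"
          using mem[of s "z d + h"] s h cd by (simp add: fun_upd_twist)
        show "z(c := s) \<in> S"
          using mem[of s "z d"] s h I(2) z0[of s] by auto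
      qed
    qed
    then obtain s where s: "s > z c" "s < z c + h" "g (z c + h) - g (z c) = 
       h * (pd c F (z(c := s, d := z d + h)) - pd c F (z(c := s, d := z d)))"
      using cd z0[symmetric] by (auto simp: fun_upd_twist)
    have "\<exists>t. \<bar>t - z d\<bar> \<le> \<bar>z d + h - z d\<bar> \<and> pd c F (z(c := s, d := z d + h)) - pd c F (z(c := s, d := z d))
          = (z d + h - z d) * pd d (pd c F) (z(c := s, d := t))"
      using h s by (intro partially_diff_mvt[OF F1(2)] mem) auto
    then obtain t where t: "\<bar>t - z d\<bar> \<le> h" "pd c F (z(c := s, d := z d + h)) - pd c F (z(c := s, d := z d))
          = h * pd d (pd c F) (z(c := s, d := t))"
      using h by auto
    have "g (z c + h) - g (z c) = h * h * pd d (pd c F) (z(c := s, d := t))"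
      using s t by simp
    moreover have "z(c := s, d := t) \<in> S" using s t h by (intro mem) auto
    moreover have "g (z c + h) - g (z c) = F (z(c := z c + h, d := z d + h)) - F (z(c := z c + h)) - F (z(d := z d + h)) + F z"
    proof -
      have "z(d := z d + h, c := z c) = z(d := z d + h)" using cd by (auto simp: fun_eq_iff)
      moreover have "z(d := z d + h, c := z c + h) = z(c := z c + h, d := z d + h)"
        using cd by (simp add: fun_upd_twist)
      ultimately show ?thesis by (simp add: g_def)
    qed
    ultimately show ?thesis by metis
  qed
  then show ?thesis using I(2) by blast
qed

lemma ck_on_subset:
  assumes "ck_on k W F" "S \<subseteq> W"
  shows "ck_on k S F"
proof -
  have "partially_diff S G" if "partially_diff W G" for G
    using that assms(2) continuous_on_subset unfolding partially_diff_def by blast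
  with assms(1) show ?thesis by (induction k arbitrary: F) auto
qed

text \<open>The second difference is unchanged when c and d are exchanged, so for small h both mixed
  partials take one common value, possibly at different points near z. Their continuity then makes
  them agree at z.\<close>

lemma pd_commute:
  assumes W: "open W" "z \<in> W" and F: "csmooth_on W F"
  shows "pd c (pd d F) z = pd d (pd c F) z"
proof (rule ccontr)
  assume ne: "pd c (pd d F) z \<noteq> pd d (pd c F) z"
  then have cd: "c \<noteq> d" by auto
  \<comment> \<open>Half the gap: on S each mixed partial stays within \<delta> of its value at z,
    so a common value forces the gap to be strictly below 2 \<delta>, which is its own size.\<close>
  define \<delta> where "\<delta> = \<bar>pd c (pd d F) z - pd d (pd c F) z\<bar> / 2"
  have \<delta>: "\<delta> > 0" using ne by (simp add: \<delta>_def)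
  define S where "S = (W \<inter> pd c (pd d F) -` ball (pd c (pd d F) z) \<delta>) \<inter> (W \<inter> pd d (pd c F) -` ball (pd d (pd c F) z) \<delta>)"
  have "open S" unfolding S_def
    by (intro open_Int continuous_open_preimage csmooth_cont csmooth_pd F W open_ball)
  moreover have zS: "z \<in> S" using \<delta> W by (simp add: S_def)
  moreover have "ck_on 2 S F"
    by (rule ck_on_subset[of _ W]) (use F in \<open>auto simp: csmooth_on_def S_def\<close>)
  note second_difference_mvt[OF \<open>open S\<close> \<open>z \<in> S\<close> this]
  from this[OF cd] this[OF cd[symmetric]] obtain e1 e2 where 
    e: "e1 > 0" "e2 > 0"
      "\<And>h. 0 < h \<and> h < e1 \<Longrightarrow> (\<exists>w\<in>S.
    F (z(c := z c + h, d := z d + h)) - F (z(c := z c + h)) - F (z(d := z d + h)) + F z = h * h * pd d (pd c F) w)"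
      "\<And>h. 0 < h \<and> h < e2 \<Longrightarrow> (\<exists>w\<in>S.
    F (z(d := z d + h, c := z c + h)) - F (z(d := z d + h)) - F (z(c := z c + h)) + F z = h * h * pd c (pd d F) w)"
    by blast
  define h where "h = min e1 e2 / 2"
  have h: "0 < h" "h < e1" "h < e2" using e(1,2) by (auto simp: h_def)
  obtain w1 where w1: "w1 \<in> S" "F (z(c := z c + h, d := z d + h)) - F (z(c := z c + h)) - F (z(d := z d + h)) + F z = h * h * pd d (pd c F) w1"
    using e(3) h by blast
  obtain w2 where w2: "w2 \<in> S" "F (z(d := z d + h, c := z c + h)) - F (z(d := z d + h)) - F (z(c := z c + h)) + F z = h * h * pd c (pd d F) w2"
    using e(4) h by blast
  have tw: "z(d := z d + h, c := z c + h) = z(c := z c + h, d := z d + h)"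
    using cd by (simp add: fun_upd_twist)
  have "h * h * pd d (pd c F) w1 = h * h * pd c (pd d F) w2" using w1(2) w2(2) unfolding tw by linarith
  then have "pd d (pd c F) w1 = pd c (pd d F) w2" using h(1) by simp
  moreover have "\<bar>pd d (pd c F) w1 - pd d (pd c F) z\<bar> < \<delta>" "\<bar>pd c (pd d F) w2 - pd c (pd d F) z\<bar> < \<delta>"
    using w1(1) w2(1) by (auto simp: S_def dist_real_def)
  ultimately have "\<bar>pd c (pd d F) z - pd d (pd c F) z\<bar> < \<delta> + \<delta>" by linarith
  then show False by (simp add: \<delta>_def)
qed

subsection \<open>Total derivatives\<close>

text \<open>Total derivatives are applied one list entry at a time, whereas coordinates are indexed
  by multi-indices. This translates between the two; only multiplicities in the list matter
  (\<open>mi_add_apply\<close>).\<close>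

fun mi_add :: "'p list \<Rightarrow> ('p \<Rightarrow> nat) \<Rightarrow> ('p \<Rightarrow> nat)" where
  "mi_add [] K = K"
| "mi_add (i # is) K = Kinc (mi_add is K) i"

lemma mord_Kinc [simp]: "mord (Kinc K i) = Suc (mord K)"
proof -
  have "mord (Kinc K i) = (\<Sum>j\<in>UNIV. K j + (if j = i then 1 else 0))"
    unfolding mord_def Kinc_def by (intro sum.cong) auto
  then show ?thesis by (simp add: mord_def sum.distrib)
qed

lemma mord_zeroK [simp]: "mord zeroK = 0"
  by (simp add: mord_def zeroK_def)

lemma mord_eq_0: "mord K = 0 \<longleftrightarrow> K = zeroK"
  by (auto simp: mord_def zeroK_def fun_eq_iff)

lemma Kinc_zeroK: "Kinc zeroK i = unitK i"
  by (auto simp: Kinc_def zeroK_def unitK_def fun_eq_iff)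

lemma mord_unitK [simp]: "mord (unitK i) = 1"
  using mord_Kinc[of zeroK i] by (simp add: Kinc_zeroK del: mord_Kinc)

lemma mord_mi_add [simp]: "mord (mi_add is K) = length is + mord K"
  by (induction "is") auto

lemma mi_add_apply: "mi_add is K j = K j + count_list is j"
  by (induction "is") (auto simp: Kinc_def)

lemma count_list_klist: "count_list (klist K) j = K j"
proof -
  have rep: "count_list (replicate n x) j = (if x = j then n else 0)" for n and x :: 'a
    by (induction n) auto
  have "count_list (concat (map (\<lambda>i. replicate (K i) i) xs)) j = (if j \<in> set xs then K j else 0)"
    if "distinct xs" for xs :: "'a list"
    using that by (induction xs) (auto simp: rep)
  then show ?thesis unfolding klist_def by simp
qed

lemma mi_add_klist: "mi_add (klist K) (unitK i) = Kinc K i"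
  by (auto simp: mi_add_apply count_list_klist Kinc_def unitK_def fun_eq_iff)

lemma length_klist: "length (klist K) = mord K"
  using mord_mi_add[of "klist K" "unitK undefined"] by (simp add: mi_add_klist)

lemma mord_SucE:
  assumes "mord K = Suc m"
  obtains K' i where "K = Kinc K' i" "mord K' = m"
proof -
  have "K \<noteq> zeroK" using assms by (auto simp: mord_zeroK)
  then obtain i where i: "K i \<noteq> 0" by (auto simp: zeroK_def fun_eq_iff)
  have "K = Kinc (K(i := K i - 1)) i" using i by (auto simp: Kinc_def fun_eq_iff)
  moreover from arg_cong[OF this, of mord] have "mord (K(i := K i - 1)) = m" using assms by simp
  ultimately show ?thesis using that by blast
qed

text \<open>\<open>klist\<close> is sorted, so the new i enters in front of the block of i's, in
  general not at the head of the list. Hence Z_i Z^K is not literally the operator belonging to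
  \<open>Kinc K i\<close>: in \<open>Z_sec\<close>, Z_i has to be commuted past
  \<open>as\<close>.\<close>

lemma klist_Kinc:
  obtains as bs where "klist K = as @ bs" "klist (Kinc K i) = as @ i # bs"
proof -
  obtain l1 l2 where l: "sorted_list_of_set UNIV = l1 @ i # l2"
    using split_list[of i "sorted_list_of_set UNIV"] by auto
  have "distinct (l1 @ i # l2)"
    by (simp flip: l)
  then have n: "i \<notin> set l1" "i \<notin> set l2" by auto
  then have m: "map (\<lambda>j. replicate (Kinc K i j) j) l1 = map (\<lambda>j. replicate (K j) j) l1"
    "map (\<lambda>j. replicate (Kinc K i j) j) l2 = map (\<lambda>j. replicate (K j) j) l2"
    by (auto simp: Kinc_def intro!: map_cong)
  show ?thesis
    by (rule that[of "concat (map (\<lambda>j. replicate (K j) j) l1)" "replicate (K i) i @ concat (map (\<lambda>j. replicate (K j) j) l2)"])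
      (simp_all add: klist_def l m del: map_eq_conv, simp add: Kinc_def)
qed

text \<open>The component of D_i at each coordinate. It turns \<open>Dtot\<close> into a single sum
  over coordinates (\<open>Dtot_eq\<close>), the form in which \<open>chain_rule\<close> delivers
  derivatives.\<close>

fun Dvec :: "'p \<Rightarrow> ('p, 'q) coord \<Rightarrow> ('p, 'q) jpt \<Rightarrow> real" where
  "Dvec i (Xc j) z = (if j = i then 1 else 0)"
| "Dvec i (Uc a K) z = z (Uc a (Kinc K i))"

lemma Dtot_eq: "Dtot m i F z = (\<Sum>c | cord c \<le> m. Dvec i c z * pd c F z)"
  unfolding sum_coords_upto Dtot_def by (simp add: if_distrib[of "\<lambda>x. x * _"] cong: if_cong)

lemma Dtot_order_irrelevant:
  fixes F :: "('p::finite, 'q::finite) jpt \<Rightarrow> real"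
  assumes "depends_upto m F" "m \<le> k"
  shows "Dtot k i F = Dtot m i F"
  unfolding Dtot_eq fun_eq_iff
proof
  fix z
  show "(\<Sum>c | cord c \<le> k. Dvec i c z * pd c F z) = (\<Sum>c | cord c \<le> m. Dvec i c z * pd c F z)"
    by (rule sum.mono_neutral_right[OF finite_coords_upto])
      (use assms pd_eq_0[OF assms(1)] in \<open>auto simp: not_le\<close>)
qed

lemma csmooth_Dvec: "csmooth_on W (Dvec i c)"
proof (cases c)
  case (Xc j)
  then have "Dvec i c = (\<lambda>_. if j = i then 1 else 0)" by auto
  then show ?thesis by simp
next
  case (Uc a K)
  then have "Dvec i c = (\<lambda>z. z (Uc a (Kinc K i)))" by auto
  then show ?thesis by simp
qed

lemma csmooth_Dtot:
  assumes "open W" "csmooth_on W F"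
  shows "csmooth_on W (Dtot m i F)"
  unfolding Dtot_eq[abs_def]
  by (intro csmooth_sum csmooth_mult csmooth_Dvec csmooth_pd assms)

lemma depends_upto_Dtot:
  fixes F :: "('p::finite, 'q::finite) jpt \<Rightarrow> real"
  assumes "depends_upto m F" "m \<le> k"
  shows "depends_upto (Suc m) (Dtot k i F)"
  unfolding depends_upto_def
proof (intro allI impI)
  fix z w :: "('p, 'q) jpt" assume zw: "\<forall>c. cord c \<le> Suc m \<longrightarrow> z c = w c"
  have "Dvec i c z = Dvec i c w" if "cord c \<le> m" for c
    using that zw by (cases c) auto
  moreover have "pd c F z = pd c F w" for c
    using depends_upto_pd[OF assms(1), of c] zw unfolding depends_upto_def by (meson le_SucI)
  ultimately show "Dtot k i F z = Dtot k i F w"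
    unfolding Dtot_order_irrelevant[OF assms] Dtot_eq by (intro sum.cong) auto
qed

lemma Dtot_cong:
  assumes "open W" "z \<in> W" "\<And>w. w \<in> W \<Longrightarrow> F w = G w"
  shows "Dtot m i F z = Dtot m i G z"
  unfolding Dtot_eq using pd_cong[OF assms(1,2), of F G] assms(3) by simp

lemma Dtot_minus:
  assumes "open W" "csmooth_on W F" "csmooth_on W G" "z \<in> W"
  shows "Dtot m i (\<lambda>z. F z - G z) z = Dtot m i F z - Dtot m i G z"
  unfolding Dtot_eq by (simp add: pd_csmooth_minus[OF assms] algebra_simps sum_subtractf)

lemma Dtot_mult:
  assumes "open W" "csmooth_on W F" "csmooth_on W G" "z \<in> W"
  shows "Dtot m i (\<lambda>z. F z * G z) z = Dtot m i F z * G z + F z * Dtot m i G z"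
  unfolding Dtot_eq 
  by (simp add: pd_csmooth_mult[OF assms(2-4)] algebra_simps sum.distrib sum_distrib_left sum_distrib_right)

lemma Dtot_sum:
  assumes "open W" "\<And>a. a \<in> A \<Longrightarrow> csmooth_on W (F a)" "z \<in> W"
  shows "Dtot m i (\<lambda>z. \<Sum>a\<in>A. F a z) z = (\<Sum>a\<in>A. Dtot m i (F a) z)"
  unfolding Dtot_eq 
  by (subst sum.swap) (simp add: pd_csmooth_sum[OF assms] sum_distrib_left)

lemma Dtot_coord:
  "mord K \<le> m \<Longrightarrow> Dtot m i (\<lambda>z. z (Uc a K)) z = z (Uc a (Kinc K i))"
  unfolding Dtot_eq pd_coord
  by (simp add: if_distrib[of "\<lambda>x. _ * x"] sum.delta' finite_coords_upto cong: if_cong)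

lemma csmooth_Dlist: "open W \<Longrightarrow> csmooth_on W F \<Longrightarrow> csmooth_on W (Dlist is m F)"
  by (induction "is") (auto intro: csmooth_Dtot)

lemma depends_upto_Dlist:
  "depends_upto m F \<Longrightarrow> depends_upto (m + length is) (Dlist is m F)"
  by (induction "is") (auto intro: depends_upto_Dtot)

text \<open>The part of D_K Q^a_Y left after its terms of order |K| + 1 are split off: these are the
-\<xi>^k u^a_{K,k}, which cancel in the prolongation.\<close>

fun prolong_coeff :: "('p::finite, 'q::finite) vf \<Rightarrow> 'q \<Rightarrow> 'p list \<Rightarrow> ('p, 'q) jpt \<Rightarrow> real" where
  "prolong_coeff Y a [] = snd Y a"
| "prolong_coeff Y a (i # is) = (\<lambda>z. Dtot (1 + length is) i (prolong_coeff Y a is) z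
     - (\<Sum>k\<in>UNIV. Dtot (1 + length is) i (fst Y k) z * z (Uc a (mi_add is (unitK k)))))"

lemma depends_upto_coord: "cord c \<le> m \<Longrightarrow> depends_upto m (\<lambda>z. z c)"
  by (simp add: depends_upto_def)

lemma is_vfD:
  assumes "is_vf X U Y"
  shows "csmooth_on (Jdom X U) (fst Y i)" "csmooth_on (Jdom X U) (snd Y a)"
    "depends_upto 0 (fst Y i)" "depends_upto 0 (snd Y a)"
proof -
  have "jet_smooth_on 0 (Jdom X U) (fst Y i)" "jet_smooth_on 0 (Jdom X U) (snd Y a)"
    using assms by (auto simp: is_vf_def)
  then show "csmooth_on (Jdom X U) (fst Y i)" "csmooth_on (Jdom X U) (snd Y a)"
    "depends_upto 0 (fst Y i)" "depends_upto 0 (snd Y a)"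
    by (auto intro: jet_smooth_imp_csmooth) (auto simp: jet_smooth_on_def)
qed

lemma continuous_on_coord: "continuous_on S (\<lambda>z. z (c :: ('p, 'q) coord) :: real)"
  by (rule continuous_on_subset[OF continuous_on_product_coordinates]) auto

lemma open_Jdom:
  assumes "open X" "open U"
  shows "open (Jdom X U :: ('p::finite, 'q::finite) jpt set)"
proof -
  have "Jdom X U = xpart -` X \<inter> (upart -` U :: ('p, 'q) jpt set)"
    by (auto simp: Jdom_def)
  moreover have "continuous_on UNIV (xpart :: ('p, 'q) jpt \<Rightarrow> _)" "continuous_on UNIV (upart :: ('p, 'q) jpt \<Rightarrow> _)"
    unfolding xpart_def upart_def by (intro continuous_on_vec_lambda continuous_on_coord)+
  ultimately show ?thesis using assms by (simp add: open_Int open_vimage)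
qed

lemma csmooth_Qchar:
  assumes "open (Jdom X U)" "is_vf X U Y"
  shows "csmooth_on (Jdom X U) (Qchar Y a)"
  unfolding Qchar_def[abs_def]
  by (intro csmooth_minus csmooth_sum csmooth_mult csmooth_coord is_vfD[OF assms(2)] assms(1))

lemma depends_upto_Qchar:
  fixes Y :: "('p::finite, 'q::finite) vf"
  assumes "is_vf X U Y"
  shows "depends_upto 1 (Qchar Y a)"
  unfolding depends_upto_def
proof (intro allI impI)
  fix z w :: "('p, 'q) jpt" assume zw: "\<forall>c. cord c \<le> 1 \<longrightarrow> z c = w c"
  then have "fst Y i z = fst Y i w" "snd Y a z = snd Y a w" for i
    using is_vfD(3,4)[OF assms] unfolding depends_upto_def by auto
  then show "Qchar Y a z = Qchar Y a w"
    using zw by (simp add: Qchar_def)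
qed

lemma csmooth_prolong_coeff:
  assumes "open (Jdom X U)" "is_vf X U Y"
  shows "csmooth_on (Jdom X U) (prolong_coeff Y a is)"
proof (induction "is")
  case Nil
  then show ?case using is_vfD(2)[OF assms(2)] by simp
next
  case (Cons i "is")
  show ?case unfolding prolong_coeff.simps
    by (intro csmooth_minus csmooth_sum csmooth_mult csmooth_coord csmooth_Dtot is_vfD[OF assms(2)] assms(1) Cons)
qed

lemma depends_upto_prolong_coeff:
  fixes Y :: "('p::finite, 'q::finite) vf"
  assumes "is_vf X U Y"
  shows "depends_upto (length is) (prolong_coeff Y a is)"
proof (induction "is")
  case Nil
  then show ?case using is_vfD(4)[OF assms] by simp
next
  case (Cons i "is")
  have 1: "depends_upto (Suc (length is)) (Dtot (1 + length is) i (prolong_coeff Y a is))"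
    by (rule depends_upto_Dtot[OF Cons]) simp
  have 2: "depends_upto (Suc (length is)) (Dtot (1 + length is) i (fst Y k))" for k
    by (rule depends_upto_mono[OF depends_upto_Dtot[OF is_vfD(3)[OF assms]]]) auto
  have 3: "depends_upto (Suc (length is)) (\<lambda>z. z (Uc a (mi_add is (unitK k))))" for k
    by (rule depends_upto_coord) simp
  show ?case
    unfolding depends_upto_def prolong_coeff.simps
  proof (intro allI impI)
    fix z w :: "('p, 'q) jpt" assume zw: "\<forall>c. cord c \<le> length (i # is) \<longrightarrow> z c = w c"
    then have "Dtot (1 + length is) i (prolong_coeff Y a is) z = Dtot (1 + length is) i (prolong_coeff Y a is) w"
      "Dtot (1 + length is) i (fst Y k) z = Dtot (1 + length is) i (fst Y k) w" 
      "z (Uc a (mi_add is (unitK k))) = w (Uc a (mi_add is (unitK k)))" for k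
      using 1 2[of k] 3[of k] unfolding depends_upto_def list.size by auto
    then show "Dtot (1 + length is) i (prolong_coeff Y a is) z -
        (\<Sum>k\<in>UNIV. Dtot (1 + length is) i (fst Y k) z * z (Uc a (mi_add is (unitK k)))) =
        Dtot (1 + length is) i (prolong_coeff Y a is) w -
        (\<Sum>k\<in>UNIV. Dtot (1 + length is) i (fst Y k) w * w (Uc a (mi_add is (unitK k))))"
      by simp
  qed
qed

text \<open>D_i acts on the products \<xi>^k u^a_{K,k} by the Leibniz rule: differentiating
  u^a_{K,k} gives the new top-order sum, differentiating \<xi>^k gives the terms subtracted in
  \<open>prolong_coeff\<close>. The latter is the classical recursion for the coefficients of a
  prolonged vector field.\<close>

lemma Dlist_Qchar:
  fixes Y :: "('p::finite, 'q::finite) vf"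
  assumes W: "open (Jdom X U)" and Y: "is_vf X U Y" and z: "z \<in> Jdom X U"
  shows "Dlist is 1 (Qchar Y a) z =
    prolong_coeff Y a is z - (\<Sum>k\<in>UNIV. fst Y k z * z (Uc a (mi_add is (unitK k))))"
  using z
proof (induction "is" arbitrary: z)
  case Nil
  then show ?case by (simp add: Qchar_def)
next
  case (Cons i "is")
  note sm = csmooth_sum csmooth_mult csmooth_coord is_vfD[OF Y] csmooth_prolong_coeff[OF W Y]
  let ?m = "1 + length is" and ?u = "\<lambda>k z. z (Uc a (mi_add is (unitK k)))"
  have "Dlist (i # is) 1 (Qchar Y a) z =
     Dtot ?m i (\<lambda>z. prolong_coeff Y a is z - (\<Sum>k\<in>UNIV. fst Y k z * ?u k z)) z"
    unfolding Dlist.simps by (rule Dtot_cong[OF W Cons.prems Cons.IH])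
  also have "\<dots> = Dtot ?m i (prolong_coeff Y a is) z - Dtot ?m i (\<lambda>z. \<Sum>k\<in>UNIV. fst Y k z * ?u k z) z"
    by (intro Dtot_minus[OF W] sm W Cons.prems)
  also have "Dtot ?m i (\<lambda>z. \<Sum>k\<in>UNIV. fst Y k z * ?u k z) z = (\<Sum>k\<in>UNIV. Dtot ?m i (\<lambda>z. fst Y k z * ?u k z) z)"
    by (intro Dtot_sum[OF W] sm W Cons.prems)
  also have "\<dots> = (\<Sum>k\<in>UNIV. Dtot ?m i (fst Y k) z * ?u k z + fst Y k z * Dtot ?m i (?u k) z)"
    by (intro sum.cong Dtot_mult[OF W] sm refl Cons.prems)
  \<comment> \<open>The coordinate in \<open>?u k\<close> has order exactly \<open>?m\<close>, so
    the operator truncated at \<open>?m\<close> still raises its multi-index.\<close>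
  also have "\<dots> = (\<Sum>k\<in>UNIV. Dtot ?m i (fst Y k) z * ?u k z + fst Y k z * z (Uc a (mi_add (i # is) (unitK k))))"
    by (simp add: Dtot_coord)
  finally show ?case by (simp add: sum.distrib)
qed

lemma DK_Qchar:
  assumes "open (Jdom X U)" "is_vf X U Y" "z \<in> Jdom X U"
  shows "DK 1 K (Qchar Y a) z =
    prolong_coeff Y a (klist K) z - (\<Sum>k\<in>UNIV. fst Y k z * z (Uc a (Kinc K k)))"
  unfolding DK_def using Dlist_Qchar[OF assms] by (simp add: mi_add_klist)

lemma prolong_Uc:
  assumes "open (Jdom X U)" "is_vf X U Y" "z \<in> Jdom X U" "mord K \<le> n"
  shows "prolong n Y z (Uc a K) = prolong_coeff Y a (klist K) z"
  using DK_Qchar[OF assms(1-3), of K a] assms(4) by (simp add: prolong_def)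

subsection \<open>Vector fields as derivations of functions on the base\<close>

text \<open>For non-zero K the value at \<open>Uc a K\<close> is a dummy: the sums that represent Y
  run over coordinates of order 0.\<close>

fun vf_coeff :: "('p, 'q) vf \<Rightarrow> ('p, 'q) coord \<Rightarrow> ('p, 'q) jpt \<Rightarrow> real" where
  "vf_coeff Y (Xc i) = fst Y i"
| "vf_coeff Y (Uc a K) = snd Y a"

lemma base_apply_eq: "base_apply Y f z = (\<Sum>c | cord c \<le> 0. vf_coeff Y c z * pd c f z)"
  unfolding sum_coords_upto base_apply_def by (simp add: mord_eq_0)

lemma csmooth_vf_coeff: "is_vf X U Y \<Longrightarrow> csmooth_on (Jdom X U) (vf_coeff Y c)"
  by (cases c) (auto intro: is_vfD)

lemma csmooth_base_apply:
  assumes "open (Jdom X U)" "is_vf X U Y" "csmooth_on (Jdom X U) f"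
  shows "csmooth_on (Jdom X U) (base_apply Y f)"
  unfolding base_apply_eq[abs_def]
  by (intro csmooth_sum csmooth_mult csmooth_vf_coeff csmooth_pd assms)

lemma depends_upto_base_apply:
  fixes Y :: "('p::finite, 'q::finite) vf"
  assumes "is_vf X U Y" "depends_upto 0 f"
  shows "depends_upto 0 (base_apply Y f)"
  unfolding depends_upto_def
proof (intro allI impI)
  fix z w :: "('p, 'q) jpt" assume zw: "\<forall>c. cord c \<le> 0 \<longrightarrow> z c = w c"
  then have "fst Y i z = fst Y i w" "snd Y a z = snd Y a w" "pd c f z = pd c f w" for i a c
    using is_vfD(3,4)[OF assms(1)] depends_upto_pd[OF assms(2)] unfolding depends_upto_def by auto
  then show "base_apply Y f z = base_apply Y f w"
    by (simp add: base_apply_def)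
qed

lemma base_apply_cong:
  assumes "open W" "z \<in> W" "\<And>w. w \<in> W \<Longrightarrow> f w = g w"
  shows "base_apply Y f z = base_apply Y g z"
  unfolding base_apply_eq using pd_cong[OF assms(1,2), of f g] assms(3) by simp

text \<open>The second sum, built from second partials of f, is symmetric in Y1 and Y2 once mixed
  partials commute. What survives in the commutator is the difference of the first sums, whose
  coefficients are those of \<open>vf_bracket Y1 Y2\<close>.\<close>

lemma base_apply_twice:
  assumes W: "open (Jdom X U)" and Y: "is_vf X U Y2" and f: "csmooth_on (Jdom X U) f" and z: "z \<in> Jdom X U"
  shows "base_apply Y1 (base_apply Y2 f) z =
     (\<Sum>d | cord d \<le> 0. base_apply Y1 (vf_coeff Y2 d) z * pd d f z) +
     (\<Sum>d | cord d \<le> 0. \<Sum>c | cord c \<le> 0. vf_coeff Y1 c z * (vf_coeff Y2 d z * pd c (pd d f) z))"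
proof -
  have "pd c (base_apply Y2 f) z = (\<Sum>d | cord d \<le> 0. pd c (vf_coeff Y2 d) z * pd d f z + vf_coeff Y2 d z * pd c (pd d f) z)" for c
  proof -
    have "pd c (base_apply Y2 f) z = (\<Sum>d | cord d \<le> 0. pd c (\<lambda>z. vf_coeff Y2 d z * pd d f z) z)"
      unfolding base_apply_eq[abs_def]
      by (intro pd_csmooth_sum[OF W] csmooth_mult W csmooth_vf_coeff Y csmooth_pd f z)
    also have "\<dots> = (\<Sum>d | cord d \<le> 0. pd c (vf_coeff Y2 d) z * pd d f z + vf_coeff Y2 d z * pd c (pd d f) z)"
      by (intro sum.cong refl pd_csmooth_mult[where W = "Jdom X U"] csmooth_vf_coeff Y csmooth_pd f z)
    finally show ?thesis .
  qed
  then have "base_apply Y1 (base_apply Y2 f) z = (\<Sum>c | cord c \<le> 0. \<Sum>d | cord d \<le> 0.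
      vf_coeff Y1 c z * pd c (vf_coeff Y2 d) z * pd d f z + vf_coeff Y1 c z * (vf_coeff Y2 d z * pd c (pd d f) z))"
    unfolding base_apply_eq[of Y1] by (simp add: sum_distrib_left algebra_simps)
  also have "\<dots> = (\<Sum>d | cord d \<le> 0. \<Sum>c | cord c \<le> 0.
      vf_coeff Y1 c z * pd c (vf_coeff Y2 d) z * pd d f z + vf_coeff Y1 c z * (vf_coeff Y2 d z * pd c (pd d f) z))"
    by (rule sum.swap)
  finally show ?thesis
    unfolding base_apply_eq[of Y1] by (simp add: sum.distrib sum_distrib_right)
qed

lemma base_apply_commute:
  assumes W: "open (Jdom X U)" and Y: "is_vf X U Y1" "is_vf X U Y2" 
    and f: "csmooth_on (Jdom X U) f" and z: "z \<in> Jdom X U"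
    and br: "vf_eq_on (Jdom X U) (vf_bracket Y1 Y2) vf_zero"
  shows "base_apply Y1 (base_apply Y2 f) z = base_apply Y2 (base_apply Y1 f) z"
proof -
  have "base_apply Y1 (vf_coeff Y2 d) z = base_apply Y2 (vf_coeff Y1 d) z" for d
    using br z by (cases d) (auto simp: vf_eq_on_def vf_bracket_def vf_zero_def)
  moreover have "(\<Sum>d | cord d \<le> 0. \<Sum>c | cord c \<le> 0. vf_coeff Y1 c z * (vf_coeff Y2 d z * pd c (pd d f) z)) =
     (\<Sum>d | cord d \<le> 0. \<Sum>c | cord c \<le> 0. vf_coeff Y2 c z * (vf_coeff Y1 d z * pd c (pd d f) z))"
    by (subst sum.swap) (intro sum.cong refl, simp add: pd_commute[OF W z f] algebra_simps)
  ultimately show ?thesis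
    unfolding base_apply_twice[OF W Y(2) f z] base_apply_twice[OF W Y(1) f z] by simp
qed

subsection \<open>The holonomic section of a commuting frame\<close>

locale commuting_frame =
  fixes X :: "(real ^ 'p::{finite,linorder}) set" and U :: "(real ^ 'q::finite) set"
    and \<phi> :: "'p \<Rightarrow> 'q \<Rightarrow> ('p, 'q) jpt \<Rightarrow> real" and Z :: "'p \<Rightarrow> ('p, 'q) vf"
  assumes Z_eq: "\<And>k. Z k = ((\<lambda>i z. if i = k then 1 else 0), \<phi> k)"
    and open_X: "open X" and open_U: "open U"
    and vf_Z: "\<And>k. is_vf X U (Z k)"
    and bracket_Z: "\<And>i j. vf_eq_on (Jdom X U) (vf_bracket (Z i) (Z j)) vf_zero"
begin

abbreviation W :: "('p, 'q) jpt set" where "W \<equiv> Jdom X U"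

lemma open_W: "open W"
  using open_X open_U by (rule open_Jdom)

lemma fst_Z [simp]: "fst (Z k) i z = (if i = k then 1 else 0)" and snd_Z [simp]: "snd (Z k) = \<phi> k"
  by (simp_all add: Z_eq)

fun Zlist :: "'p list \<Rightarrow> (('p, 'q) jpt \<Rightarrow> real) \<Rightarrow> ('p, 'q) jpt \<Rightarrow> real" where
  "Zlist [] f = f"
| "Zlist (i # is) f = base_apply (Z i) (Zlist is f)"

lemma Zlist_append: "Zlist (as @ bs) f = Zlist as (Zlist bs f)"
  by (induction as) auto

lemma csmooth_Zlist: "csmooth_on W f \<Longrightarrow> csmooth_on W (Zlist is f)"
  by (induction "is") (auto intro: csmooth_base_apply[OF open_W vf_Z])

lemma depends_upto_Zlist: "depends_upto 0 f \<Longrightarrow> depends_upto 0 (Zlist is f)"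
  by (induction "is") (auto intro: depends_upto_base_apply[OF vf_Z])

lemma Zlist_cong:
  assumes "z \<in> W" "\<And>w. w \<in> W \<Longrightarrow> f w = g w"
  shows "Zlist is f z = Zlist is g z"
  using assms(1)
proof (induction "is" arbitrary: z)
  case (Cons i "is")
  show ?case unfolding Zlist.simps
    by (rule base_apply_cong[OF open_W]) (rule Cons)+
qed (simp add: assms(2))

lemma Zlist_zero [simp]: "Zlist is (\<lambda>_. 0) = (\<lambda>_. 0)"
  by (induction "is") (auto simp: base_apply_def)

lemma Zlist_commute:
  assumes "csmooth_on W f" "z \<in> W"
  shows "base_apply (Z i) (Zlist is f) z = Zlist is (base_apply (Z i) f) z"
  using assms(2)
proof (induction "is" arbitrary: z)
  case (Cons j "is")
  have "base_apply (Z i) (Zlist (j # is) f) z = base_apply (Z j) (base_apply (Z i) (Zlist is f)) z"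
    unfolding Zlist.simps
    by (intro base_apply_commute[OF open_W vf_Z vf_Z] csmooth_Zlist bracket_Z assms(1) Cons.prems)
  also have "\<dots> = Zlist (j # is) (base_apply (Z i) f) z"
    unfolding Zlist.simps by (rule base_apply_cong[OF open_W]) (rule Cons)+
  finally show ?case .
qed simp

text \<open>Only the order-0 part of z is read, and it is reproduced: this is a section over X
  \<times> U written on jet points. All orders are filled at once, including order n + 1, on which
  \<open>char_sys n\<close> is silent.\<close>

fun sec :: "('p, 'q) jpt \<Rightarrow> ('p, 'q) coord \<Rightarrow> real" where
  "sec z (Xc i) = z (Xc i)"
| "sec z (Uc a K) = Zlist (klist K) (\<lambda>w. w (Uc a zeroK)) z"

lemma klist_zeroK [simp]: "klist zeroK = []"
  using length_klist[of zeroK] by simp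

lemma sec_order_0: "cord c = 0 \<Longrightarrow> sec z c = z c"
  by (cases c) (auto simp: mord_eq_0)

lemma sec_in_W: "z \<in> W \<Longrightarrow> sec z \<in> W"
  by (simp add: Jdom_def xpart_def upart_def)

lemma csmooth_sec: "csmooth_on W (\<lambda>z. sec z c)"
  by (cases c) (auto intro!: csmooth_Zlist)

lemma depends_upto_sec: "depends_upto 0 (\<lambda>z. sec z c)"
  by (cases c) (auto intro!: depends_upto_Zlist depends_upto_coord)

text \<open>Moving the base point along Z_i moves \<open>sec\<close> along D_i, so its image is an
  integral manifold of the total derivatives. For a coordinate \<open>Uc a K\<close>, Z_i is carried
  through \<open>as\<close> to its place in \<open>klist (Kinc K i)\<close>.\<close>

lemma Z_sec:
  assumes "z \<in> W"
  shows "base_apply (Z i) (\<lambda>w. sec w c) z = Dvec i c (sec z)"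
proof (cases c)
  case (Xc j)
  then show ?thesis by (simp add: base_apply_def pd_coord if_distrib[of "\<lambda>x. _ * x"] cong: if_cong)
next
  case (Uc a K)
  let ?u = "\<lambda>w :: ('p, 'q) jpt. w (Uc a zeroK)"
  obtain as bs where k: "klist K = as @ bs" "klist (Kinc K i) = as @ i # bs"
    by (rule klist_Kinc)
  have "base_apply (Z i) (Zlist (as @ bs) ?u) z = Zlist as (base_apply (Z i) (Zlist bs ?u)) z"
    unfolding Zlist_append by (intro Zlist_commute csmooth_Zlist csmooth_coord assms)
  then show ?thesis using Uc by (simp add: k Zlist_append)
qed

lemma pd_comp_sec:
  assumes "csmooth_on W F" "depends_upto m F" "z \<in> W"
  shows "pd d (\<lambda>w. F (sec w)) z = (\<Sum>c | cord c \<le> m. pd d (\<lambda>w. sec w c) z * pd c F (sec z))"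
proof (rule pd_eqI)
  have "((\<lambda>t. F (sec (z(d := t)))) has_real_derivative
      (\<Sum>c | cord c \<le> m. pd d (\<lambda>w. sec w c) z * pd c F (sec (z(d := z d))))) (at (z d))"
    by (rule chain_rule[OF open_W _ assms(1,2)])
      (use sec_in_W[OF assms(3)] partially_diff_pd[OF csmooth_imp_partially_diff[OF csmooth_sec] assms(3)] in simp_all)
  then show "((\<lambda>t. F (sec (z(d := t)))) has_real_derivative
      (\<Sum>c | cord c \<le> m. pd d (\<lambda>w. sec w c) z * pd c F (sec z))) (at (z d))"
    by simp
qed

text \<open>The chain rule produces the factors Z_i(sec_c), which \<open>Z_sec\<close> identifies as
  the components of D_i at \<open>sec z\<close>.\<close>

lemma Dtot_sec:
  assumes "csmooth_on W F" "depends_upto m F" "z \<in> W"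
  shows "Dtot m i F (sec z) = base_apply (Z i) (\<lambda>w. F (sec w)) z"
proof -
  have "base_apply (Z i) (\<lambda>w. F (sec w)) z = 
     (\<Sum>d | cord d \<le> 0. \<Sum>c | cord c \<le> m. vf_coeff (Z i) d z * pd d (\<lambda>w. sec w c) z * pd c F (sec z))"
    unfolding base_apply_eq by (simp add: pd_comp_sec[OF assms] sum_distrib_left mult.assoc)
  also have "\<dots> = (\<Sum>c | cord c \<le> m. base_apply (Z i) (\<lambda>w. sec w c) z * pd c F (sec z))"
    unfolding base_apply_eq by (subst sum.swap) (simp add: sum_distrib_right)
  finally show ?thesis by (simp add: Z_sec[OF assms(3)] Dtot_eq)
qed

lemma Dlist_sec:
  assumes "csmooth_on W F" "depends_upto m F" "z \<in> W"
  shows "Dlist is m F (sec z) = Zlist is (\<lambda>w. F (sec w)) z"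
  using assms(3)
proof (induction "is" arbitrary: z)
  case (Cons i "is")
  have "Dlist (i # is) m F (sec z) = base_apply (Z i) (\<lambda>w. Dlist is m F (sec w)) z"
    unfolding Dlist.simps
    by (intro Dtot_sec csmooth_Dlist depends_upto_Dlist open_W assms Cons.prems)
  also have "\<dots> = Zlist (i # is) (\<lambda>w. F (sec w)) z"
    unfolding Zlist.simps by (rule base_apply_cong[OF open_W]) (rule Cons)+
  finally show ?case .
qed simp

text \<open>This is Y = \<Sum>\<xi>^k Z_k pointwise: Z_k projects to the k-th coordinate field, so
  the coefficients can only be the \<xi>^k of Y itself. They may be functions of (x, u) and not
  constants, which lets the notion cover elements of \<open>L\<close> as well as of
  \<open>L'\<close>.\<close>

definition frame_combination :: "('p, 'q) vf \<Rightarrow> bool" where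
  "frame_combination Y \<longleftrightarrow> is_vf X U Y \<and> (\<forall>z\<in>W. \<forall>a. snd Y a z = (\<Sum>k\<in>UNIV. fst Y k z * \<phi> k a z))"

lemma frame_combination_Z: "frame_combination (Z k)"
  using vf_Z by (simp add: frame_combination_def if_distrib[of "\<lambda>x. x * _"] cong: if_cong)

lemma sec_unitK: "z \<in> W \<Longrightarrow> sec z (Uc a (unitK k)) = \<phi> k a z"
proof -
  assume z: "z \<in> W"
  have "base_apply (Z k) (\<lambda>w. sec w (Uc a zeroK)) z = \<phi> k a z"
    by (simp add: base_apply_def pd_coord if_distrib[of "\<lambda>x. _ * x"] cong: if_cong)
  then show ?thesis using Z_sec[OF z, of k "Uc a zeroK"] by (simp add: Kinc_zeroK del: sec.simps)
qed

lemma vf_at_sec: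
  assumes "is_vf X U Y"
  shows "fst Y k (sec z) = fst Y k z" "snd Y a (sec z) = snd Y a z"
  using is_vfD(3,4)[OF assms] sec_order_0 unfolding depends_upto_def by auto

lemma Qchar_sec:
  assumes "is_vf X U Y" "z \<in> W"
  shows "Qchar Y a (sec z) = snd Y a z - (\<Sum>k\<in>UNIV. fst Y k z * \<phi> k a z)"
  unfolding Qchar_def by (simp add: vf_at_sec[OF assms(1)] sec_unitK[OF assms(2)] del: sec.simps)

text \<open>By \<open>Dlist_sec\<close> the left side is an iterated Z-derivative of Q_Y composed
  with \<open>sec\<close>, a function that vanishes on all of the open set W and not only at
  z.\<close>

lemma Dlist_Qchar_sec:
  assumes "frame_combination Y" "z \<in> W"
  shows "Dlist is 1 (Qchar Y a) (sec z) = 0"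
proof -
  have vf: "is_vf X U Y" using assms(1) by (simp add: frame_combination_def)
  have "Dlist is 1 (Qchar Y a) (sec z) = Zlist is (\<lambda>w. Qchar Y a (sec w)) z"
    by (intro Dlist_sec csmooth_Qchar depends_upto_Qchar[OF vf] open_W vf assms(2))
  also have "\<dots> = Zlist is (\<lambda>_. 0) z"
    by (rule Zlist_cong[OF assms(2)]) (use assms(1) Qchar_sec[OF vf] in \<open>simp add: frame_combination_def\<close>)
  finally show ?thesis by simp
qed

lemma prolong_coeff_sec:
  assumes "frame_combination Y" "z \<in> W"
  shows "prolong_coeff Y a (klist K) (sec z) = (\<Sum>k\<in>UNIV. fst Y k z * sec z (Uc a (Kinc K k)))"
proof -
  have vf: "is_vf X U Y" using assms(1) by (simp add: frame_combination_def)
  show ?thesis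
    using Dlist_Qchar[OF open_W vf sec_in_W[OF assms(2)], of "klist K" a] Dlist_Qchar_sec[OF assms, of "klist K" a]
    by (simp add: mi_add_klist vf_at_sec[OF vf] del: sec.simps)
qed

section \<open>The characteristic system as a graph, and curves in it\<close>

definition holonomic :: "nat \<Rightarrow> ('p, 'q) jpt \<Rightarrow> bool" where
  "holonomic n z \<longleftrightarrow> z \<in> W \<and> (\<forall>c. cord c \<le> n \<longrightarrow> z c = sec z c)"

lemma holonomic_eq_sec:
  assumes "holonomic n z" "depends_upto m F" "m \<le> n"
  shows "F z = F (sec z)"
  using assms unfolding holonomic_def depends_upto_def by (meson order.trans)

text \<open>For Z_i the equation D_K Q = 0 is solved for its leading coordinate: u^a_{K,i} equals a
  \<open>prolong_coeff\<close> of order at most |K|. Climbing in the order determines z up to order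
  n from its base point, and \<open>sec\<close> obeys the same recursion.\<close>

lemma char_sys_frame:
  assumes "\<And>k. Z k \<in> L'" "\<And>Y. Y \<in> L' \<Longrightarrow> frame_combination Y" "n \<ge> 1"
  shows "char_sys n X U L' = {z. holonomic n z}"
proof (intro set_eqI iffI)
  fix z assume "z \<in> {z. holonomic n z}"
  then have z: "holonomic n z" "z \<in> W" by (auto simp: holonomic_def)
  have "DK 1 K (Qchar Y a) z = 0" if "Y \<in> L'" "mord K \<le> n - 1" for Y a K
  proof -
    have "depends_upto (1 + length (klist K)) (Dlist (klist K) 1 (Qchar Y a))" (is "depends_upto _ ?F")
      using assms(2)[OF that(1)] by (intro depends_upto_Dlist depends_upto_Qchar) (auto simp: frame_combination_def)
    \<comment> \<open>The order 1 + |K| is at most n because n >= 1. For n = 0 the truncated n - 1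
      would still impose the first-order equations of K = 0.\<close>
    then have "?F z = ?F (sec z)"
      by (rule holonomic_eq_sec[OF z(1)]) (use that(2) assms(3) in \<open>simp add: length_klist\<close>)
    then show ?thesis
      unfolding DK_def Dlist_Qchar_sec[OF assms(2)[OF that(1)] z(2)] .
  qed
  then show "z \<in> char_sys n X U L'" using z by (simp add: char_sys_def)
next
  fix z assume z: "z \<in> char_sys n X U L'"
  then have zW: "z \<in> W" by (simp add: char_sys_def)
  have "holonomic m z" if "m \<le> n" for m
    using that
  proof (induction m)
    case 0
    then show ?case using zW sec_order_0 by (simp add: holonomic_def)
  next
    case (Suc m)
    then have hol: "holonomic m z" by simp
    have "z c = sec z c" if ord: "cord c = Suc m" for c
    proof -
      obtain a K i where c: "c = Uc a (Kinc K i)" "mord K = m"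
        using ord by (cases c) (auto elim: mord_SucE)
      have "DK 1 K (Qchar (Z i) a) z = 0"
        using z assms(1) c(2) Suc.prems by (auto simp: char_sys_def)
      then have "z c = prolong_coeff (Z i) a (klist K) z"
        using DK_Qchar[OF open_W vf_Z zW, of K i a] c
        by (simp add: if_distrib[of "\<lambda>x. x * _"] cong: if_cong)
      also have "\<dots> = prolong_coeff (Z i) a (klist K) (sec z)"
        using holonomic_eq_sec[OF hol depends_upto_prolong_coeff[OF vf_Z]] by (simp add: length_klist c(2))
      also have "\<dots> = sec z c"
        unfolding prolong_coeff_sec[OF frame_combination_Z zW] c
        by (simp add: if_distrib[of "\<lambda>x. x * _"] del: sec.simps cong: if_cong)
      finally show ?thesis .
    qed
    then show ?case using hol by (auto simp: holonomic_def le_Suc_eq)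
  qed
  then show "z \<in> {z. holonomic n z}" by simp
qed

text \<open>Tangency concerns only the velocity at 0, so no flow has to be integrated: a straight
  line in the base with direction Y(z), lifted by \<open>sec\<close>, is enough.\<close>

lemma holonomic_curve:
  assumes Y: "frame_combination Y" and z: "holonomic n z"
  shows "\<exists>\<gamma> \<epsilon>. \<epsilon> > 0 \<and> \<gamma> 0 = z \<and> (\<forall>t. \<bar>t\<bar> < \<epsilon> \<longrightarrow> holonomic n (\<gamma> t)) \<and>
    (\<forall>c. ((\<lambda>t. \<gamma> t c) has_real_derivative prolong n Y z c) (at 0))"
proof -
  have vf: "is_vf X U Y" using Y by (simp add: frame_combination_def)
  have zW: "z \<in> W" using z by (simp add: holonomic_def)
  define b where "b t c = z c + (if cord c = 0 then t * vf_coeff Y c z else 0)" for t c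
  \<comment> \<open>Above order n the curve rests, matching the value 0 that
    \<open>prolong n\<close> takes there.\<close>
  define \<gamma> where "\<gamma> t c = (if cord c \<le> n then sec (b t) c else z c)" for t c
  have b0: "b 0 = z" by (auto simp: b_def)
  have sec_b: "sec (\<gamma> t) c = sec (b t) c" for t c
    using depends_upto_sec[of c] sec_order_0 unfolding depends_upto_def by (simp add: \<gamma>_def)
  have \<gamma>0: "\<gamma> 0 = z" using z by (auto simp: \<gamma>_def b0 holonomic_def)
  have memb: "\<gamma> t \<in> W \<longleftrightarrow> b t \<in> W" for t
    by (simp add: Jdom_def xpart_def upart_def \<gamma>_def)
  obtain I e where I: "finite I" "e > 0" "\<And>y. (\<And>i. i \<in> I \<Longrightarrow> \<bar>y i - z i\<bar> < e) \<Longrightarrow> y \<in> W"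
    using open_jpt_box[OF open_W zW] by blast
  have db: "((\<lambda>t. b t c) has_real_derivative (if cord c = 0 then vf_coeff Y c z else 0)) (at t0)" for c t0
    unfolding b_def by (auto intro!: derivative_eq_intros)
  have "\<forall>\<^sub>F t in nhds 0. \<bar>b t c - z c\<bar> < e" for c
  proof -
    have "((\<lambda>t. b t c) \<longlongrightarrow> b 0 c) (nhds 0)"
      using DERIV_isCont[OF db[of c 0]] by (simp add: isCont_def tendsto_at_iff_tendsto_nhds[of "\<lambda>t. b t c" 0])
    then show ?thesis using I(2) b0 by (auto simp: tendsto_iff dist_real_def)
  qed
  then have "\<forall>\<^sub>F t in nhds 0. \<forall>c\<in>I. \<bar>b t c - z c\<bar> < e"
    using I(1) by (simp add: eventually_ball_finite_distrib)
  then have "\<forall>\<^sub>F t in nhds 0. b t \<in> W"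
    by eventually_elim (auto intro: I(3))
  then obtain \<epsilon> where \<epsilon>: "\<epsilon> > 0" "\<And>t. \<bar>t\<bar> < \<epsilon> \<Longrightarrow> b t \<in> W"
    by (auto simp: eventually_nhds_metric dist_real_def)
  have "holonomic n (\<gamma> t)" if "\<bar>t\<bar> < \<epsilon>" for t
    unfolding holonomic_def sec_b memb using \<epsilon>(2)[OF that] by (simp add: \<gamma>_def)
  moreover have "((\<lambda>t. \<gamma> t c) has_real_derivative prolong n Y z c) (at 0)" for c
  proof (cases "cord c \<le> n")
    case False
    then have "prolong n Y z c = 0" by (cases c) (auto simp: prolong_def)
    then show ?thesis using False by (simp add: \<gamma>_def)
  next
    case True
    have "((\<lambda>t. sec (b t) c) has_real_derivative
        (\<Sum>d | cord d \<le> 0. vf_coeff Y d z * pd d (\<lambda>w. sec w c) (b 0))) (at 0)"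
      by (rule chain_rule[OF open_W _ csmooth_sec depends_upto_sec]) (use zW b0 db[of _ 0] in \<open>auto dest: spec simp del: cord.simps intro: DERIV_cong[OF db]\<close>)
    then have "((\<lambda>t. \<gamma> t c) has_real_derivative base_apply Y (\<lambda>w. sec w c) z) (at 0)"
      using True by (simp add: \<gamma>_def b0 base_apply_eq)
    moreover have "base_apply Y (\<lambda>w. sec w c) z = prolong n Y z c"
    proof -
      have "base_apply Y (\<lambda>w. sec w c) z = (\<Sum>k\<in>UNIV. fst Y k z * base_apply (Z k) (\<lambda>w. sec w c) z)"
      proof -
        have "(\<Sum>a\<in>UNIV. snd Y a z * pd (Uc a zeroK) (\<lambda>w. sec w c) z) =
          (\<Sum>a\<in>UNIV. \<Sum>k\<in>UNIV. fst Y k z * (\<phi> k a z * pd (Uc a zeroK) (\<lambda>w. sec w c) z))"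
          using Y zW by (simp add: frame_combination_def sum_distrib_right mult.assoc)
        also have "\<dots> = (\<Sum>k\<in>UNIV. fst Y k z * (\<Sum>a\<in>UNIV. \<phi> k a z * pd (Uc a zeroK) (\<lambda>w. sec w c) z))"
          by (subst sum.swap) (simp add: sum_distrib_left)
        finally show ?thesis
          unfolding base_apply_def
          by (simp add: sum.distrib distrib_left if_distrib[of "\<lambda>x. x * _"] del: sec.simps cong: if_cong)
      qed
      also have "\<dots> = (\<Sum>k\<in>UNIV. fst Y k z * Dvec k c (sec z))"
        by (simp add: Z_sec[OF zW])
      also have "\<dots> = prolong n Y z c"
      proof (cases c)
        case (Xc i)
        then show ?thesis
          by (simp add: prolong_def if_distrib[of "\<lambda>x. _ * x"] cong: if_cong)
      next
        case (Uc a K)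
        with True have K: "mord K \<le> n" by simp
        \<comment> \<open>For |K| = n the definition of \<open>prolong\<close> involves coordinates
          of order n + 1, where z and \<open>sec z\<close> may differ. The cancelled form has order
          at most |K|, so z can be replaced by \<open>sec z\<close>.\<close>
        have "prolong n Y z c = prolong_coeff Y a (klist K) (sec z)"
          unfolding Uc prolong_Uc[OF open_W vf zW K]
          by (rule holonomic_eq_sec[OF z depends_upto_prolong_coeff[OF vf]]) (simp add: length_klist K)
        then show ?thesis
          using prolong_coeff_sec[OF Y zW] Uc by simp
      qed
      finally show ?thesis .
    qed
    ultimately show ?thesis by simp
  qed
  ultimately show ?thesis using \<epsilon>(1) \<gamma>0 by blast
qed

text \<open>At a point, the Z_k and a basis of L' are related by a p \<times> p matrix whose inverse is formed by
the \<xi>-components of the basis.\<close>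

lemma frame_combination_of_dim:
  assumes dim: "vf_dim X U L' CARD('p)" and Z: "\<And>k. Z k \<in> L'" and vf: "is_vf X U Y" and Y: "Y \<in> L'"
  shows "frame_combination Y"
  unfolding frame_combination_def
proof (intro conjI ballI allI vf)
  fix z a assume z: "z \<in> W"
  obtain B where B: "finite B" "card B = CARD('p)" "\<And>Y. Y \<in> L' \<Longrightarrow> \<exists>c. vf_eq_on W Y (vf_comb c B)"
    using dim unfolding vf_dim_def by blast
  obtain b :: "'p \<Rightarrow> _" where b: "bij_betw b UNIV B"
    using B(1,2) finite_same_card_bij[of "UNIV :: 'p set" B] by auto
  have comb: "\<exists>c. (\<forall>i. fst Y i z = (\<Sum>j\<in>UNIV. c j * fst (b j) i z)) \<and> (\<forall>a. snd Y a z = (\<Sum>j\<in>UNIV. c j * snd (b j) a z))"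
    if "Y \<in> L'" for Y
  proof -
    obtain c where "vf_eq_on W Y (vf_comb c B)" using B(3)[OF \<open>Y \<in> L'\<close>] by blast
    then have "fst Y i z = (\<Sum>j\<in>UNIV. c (b j) * fst (b j) i z)" "snd Y a z = (\<Sum>j\<in>UNIV. c (b j) * snd (b j) a z)" for i a
      using z sum.reindex_bij_betw[OF b, of "\<lambda>y. c y * fst y i z"] sum.reindex_bij_betw[OF b, of "\<lambda>y. c y * snd y a z"]
      by (auto simp: vf_eq_on_def vf_comb_def)
    then show ?thesis by (intro exI[of _ "\<lambda>j. c (b j)"]) auto
  qed
  have "\<forall>k. \<exists>c. (\<forall>i. fst (Z k) i z = (\<Sum>j\<in>UNIV. c j * fst (b j) i z)) \<and> (\<forall>a. snd (Z k) a z = (\<Sum>j\<in>UNIV. c j * snd (b j) a z))"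
    using comb[OF Z] by blast
  from choice[OF this] obtain A where
    A: "\<And>k i. fst (Z k) i z = (\<Sum>j\<in>UNIV. A k j * fst (b j) i z)" "\<And>k a. snd (Z k) a z = (\<Sum>j\<in>UNIV. A k j * snd (b j) a z)"
    by blast
  obtain c where c: "\<And>i. fst Y i z = (\<Sum>j\<in>UNIV. c j * fst (b j) i z)" "\<And>a. snd Y a z = (\<Sum>j\<in>UNIV. c j * snd (b j) a z)"
    using comb[OF Y] by blast
  define M1 where "M1 = (\<chi> k j. A k j)"
  define M2 where "M2 = (\<chi> j i. fst (b j) i z)"
  have "M1 ** M2 = mat 1"
    by (auto simp: M1_def M2_def matrix_matrix_mult_def mat_def vec_eq_iff simp flip: A(1))
  \<comment> \<open>Since B has CARD('p) elements and is indexed by \<open>'p\<close>, both matrices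
    are square, and a one-sided inverse is two-sided.\<close>
  then have "M2 ** M1 = mat 1" by (rule matrix_left_right_inverse[THEN iffD1])
  then have inv: "(\<Sum>k\<in>UNIV. fst (b j) k z * A k l) = (if j = l then 1 else 0)" for j l
    by (simp add: M1_def M2_def matrix_matrix_mult_def mat_def vec_eq_iff)
  have snd_b: "(\<Sum>k\<in>UNIV. fst (b j) k z * \<phi> k a z) = snd (b j) a z" for j
  proof -
    have "(\<Sum>k\<in>UNIV. fst (b j) k z * \<phi> k a z) = (\<Sum>k\<in>UNIV. \<Sum>l\<in>UNIV. fst (b j) k z * A k l * snd (b l) a z)"
      using A(2)[of _ a] by (simp add: sum_distrib_left mult.assoc)
    also have "\<dots> = (\<Sum>l\<in>UNIV. (\<Sum>k\<in>UNIV. fst (b j) k z * A k l) * snd (b l) a z)"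
      by (subst sum.swap) (simp add: sum_distrib_right)
    finally show ?thesis by (simp add: inv if_distrib[of "\<lambda>x. x * _"] cong: if_cong)
  qed
  have "(\<Sum>k\<in>UNIV. fst Y k z * \<phi> k a z) = (\<Sum>k\<in>UNIV. \<Sum>j\<in>UNIV. c j * (fst (b j) k z * \<phi> k a z))"
    by (simp add: c(1) sum_distrib_right mult.assoc)
  also have "\<dots> = (\<Sum>j\<in>UNIV. c j * snd (b j) a z)"
    by (subst sum.swap) (simp add: snd_b flip: sum_distrib_left)
  finally show "snd Y a z = (\<Sum>k\<in>UNIV. fst Y k z * \<phi> k a z)" by (simp add: c(2))
qed

end

section \<open>Transfer from the frame in \<open>L'\<close> to the fields of
  \<open>L\<close>\<close>

theorem mainTheorem17:
  fixes X :: "(real ^ 'p::{finite,linorder}) set" and U :: "(real ^ 'q::finite) set"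
    and n s :: nat and \<Delta> :: "nat \<Rightarrow> ('p, 'q) jpt \<Rightarrow> real"
    and L L' :: "('p, 'q) vf set" and \<phi> :: "'p \<Rightarrow> 'q \<Rightarrow> ('p, 'q) jpt \<Rightarrow> real"
  assumes "open X" and "open U" and "n \<ge> 1"
    and "\<forall>\<mu><s. jet_smooth_on n (Jdom X U) (\<Delta> \<mu>)"
    and "vf_lie_algebra X U L"
    and "rectified_pde_lie_algebra X U L'"
    and "char_sys n X U L = char_sys n X U L'"
    and "\<forall>k. ((\<lambda>i z. if i = k then 1 else 0), \<phi> k) \<in> L'"
    and "\<forall>\<mu><s. \<forall>z\<in>char_sys n X U L'. \<Delta> \<mu> z = 0"
  shows "\<forall>Y\<in>L. tangent_to (prolong n Y) (S_Delta X U s \<Delta> \<inter> char_sys n X U L)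
           \<and> S_Delta X U s \<Delta> \<inter> char_sys n X U L = char_sys n X U L
           \<and> (\<forall>\<mu><s. \<forall>z\<in>char_sys n X U L. jvf_apply n (prolong n Y) (\<Delta> \<mu>) z = 0)"
proof -
  define Z where "Z = (\<lambda>k. ((\<lambda>(i::'p) (z::('p, 'q) jpt). if i = k then 1::real else 0), \<phi> k))"
  have L'_vf: "is_vf X U Y" if "Y \<in> L'" for Y
    using assms(6) that unfolding rectified_pde_lie_algebra_def vf_lie_algebra_def by blast
  have ZL: "Z k \<in> L'" for k using assms(8) by (simp add: Z_def)
  interpret commuting_frame X U \<phi> Z
  proof
    show "Z k = ((\<lambda>i z. if i = k then 1 else 0), \<phi> k)" for k by (simp add: Z_def)
    show "open X" "open U" by fact+
    show "is_vf X U (Z k)" for k using L'_vf[OF ZL] .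
    show "vf_eq_on (Jdom X U) (vf_bracket (Z i) (Z j)) vf_zero" for i j
      using assms(6) ZL unfolding rectified_pde_lie_algebra_def by blast
  qed
  have comb': "frame_combination Y" if "Y \<in> L'" for Y
    using assms(6) that L'_vf ZL unfolding rectified_pde_lie_algebra_def
    by (intro frame_combination_of_dim[of L']) auto
  have S: "char_sys n X U L = {z. holonomic n z}"
    unfolding assms(7) by (rule char_sys_frame[OF ZL comb' assms(3)])
  have S\<Delta>: "S_Delta X U s \<Delta> \<inter> char_sys n X U L = char_sys n X U L"
    using assms(7,9) by (auto simp: S_Delta_def char_sys_def)
  have comb: "frame_combination Y" if Y: "Y \<in> L" for Y
  proof -
    have vf: "is_vf X U Y" using assms(5) Y unfolding vf_lie_algebra_def by blast
    have "snd Y a z = (\<Sum>k\<in>UNIV. fst Y k z * \<phi> k a z)" if z: "z \<in> W" for z a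
    proof -
      \<comment> \<open>Idempotence, because only the order-0 part is read. So \<open>sec z\<close>
        lies in the system for every z in W, and the characteristic equation of Y becomes an
        identity over all of W.\<close>
      have "sec (sec z) c = sec z c" for c
        using depends_upto_sec[of c] sec_order_0 unfolding depends_upto_def by simp
      then have "sec z \<in> char_sys n X U L"
        unfolding S by (simp add: holonomic_def sec_in_W[OF z])
      then have "DK 1 zeroK (Qchar Y a) (sec z) = 0"
        using Y unfolding char_sys_def by simp
      then show ?thesis using Qchar_sec[OF vf z] by (simp add: DK_def)
    qed
    then show ?thesis using vf by (simp add: frame_combination_def)
  qed
  have tan: "tangent_to (prolong n Y) (char_sys n X U L)" if "Y \<in> L" for Y
    unfolding tangent_to_def S using holonomic_curve[OF comb[OF that]] by simp
  \<comment> \<open>The curve given by tangency stays in a set where \<open>\<Delta> \<mu>\<close>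
    vanishes, so the derivative of \<open>\<Delta> \<mu>\<close> along it is 0; the chain rule shows
    that this derivative is \<open>jvf_apply\<close>.\<close>
  have "jvf_apply n (prolong n Y) (\<Delta> \<mu>) z = 0" if Y: "Y \<in> L" and \<mu>: "\<mu> < s" and z: "z \<in> char_sys n X U L" for Y \<mu> z
  proof -
    obtain \<gamma> \<epsilon> where \<gamma>: "\<epsilon> > 0" "\<gamma> 0 = z" "\<And>t. \<bar>t\<bar> < \<epsilon> \<Longrightarrow> \<gamma> t \<in> char_sys n X U L"
      "\<And>c. ((\<lambda>t. \<gamma> t c) has_real_derivative prolong n Y z c) (at 0)"
      using tan[OF Y] z unfolding tangent_to_def by blast
    have zW: "\<gamma> 0 \<in> W" using z \<gamma>(2) by (simp add: char_sys_def)
    have sm: "jet_smooth_on n W (\<Delta> \<mu>)" using assms(4) \<mu> by blast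
    have "((\<lambda>t. \<Delta> \<mu> (\<gamma> t)) has_real_derivative (\<Sum>c | cord c \<le> n. prolong n Y z c * pd c (\<Delta> \<mu>) (\<gamma> 0))) (at 0)"
      by (rule chain_rule[OF open_W zW jet_smooth_imp_csmooth[OF sm] _ \<gamma>(4)])
        (use sm in \<open>simp add: jet_smooth_on_def\<close>)
    moreover have "\<forall>\<^sub>F t in nhds 0. \<Delta> \<mu> (\<gamma> t) = 0"
      unfolding eventually_nhds_metric using \<gamma>(1,3) assms(7,9) \<mu> by (auto simp: dist_real_def)
    then have "((\<lambda>t. \<Delta> \<mu> (\<gamma> t)) has_real_derivative 0) (at 0)"
      by (subst DERIV_cong_ev[OF refl _ refl]) auto
    ultimately show ?thesis
      unfolding jvf_apply_def \<gamma>(2) sum_coords_upto using DERIV_unique by blast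
  qed
  then show ?thesis using tan S\<Delta> by simp
qed

end
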